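(* As formal power series in $u$, \[ \sum_{n=0}^\infty P_{n}^{(\mathrm{lpk},\mathrm{ilpk})}(s,t) u^n = \frac{1}{\sqrt{1-(1-s)(1-t)u^2}}\sum_{k=0}^\infty \frac{1}{k!} \left(\frac{L\big(\sqrt{(1-s)(1-t)}\,u\big)}{\sqrt{(1-s)(1-t)}}\right)^{k} P_{k}^{\mathrm{lpk}}(s)P_{k}^{\mathrm{lpk}}(t), \] where $L(u)=\frac12\log\frac{1+u}{1-u}=\sum_{m\ge1}\frac{u^{2m-1}}{2m-1}$.
   Context: $\mathfrak{S}_n$ is the symmetric group on $[n]$. For $\pi\in\mathfrak{S}_n$, $i$ with $2\le i\le n-1$ is a peak if $\pi(i-1)<\pi(i)>\pi(i+1)$; $i\in[n-1]$ is a left peak if $i$ is a peak, or if $i=1$ and $\pi(1)>\pi(2)$; $\mathrm{lpk}(\pi)$ is the number of left peaks and $\mathrm{ilpk}(\pi)=\mathrm{lpk}(\pi^{-1})$. $P_{n}^{(\mathrm{lpk},\mathrm{ilpk})}(s,t)=\sum_{\pi\in\mathfrak{S}_{n}}s^{\mathrm{lpk}(\pi)}t^{\mathrm{ilpk}(\pi)}$ and $P_n^{\mathrm{lpk}}(t)=\sum_{\pi\in\mathfrak{S}_n}t^{\mathrm{lpk}(\pi)}$, with both equal to $1$ for $n=0$. *)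

theory Defs
  imports
    "HOL-Combinatorics.Permutations"
    "HOL-Computational_Algebra.Formal_Power_Series"
begin

text \<open>
  Permutations of \<open>[n]\<close> are functions \<open>p\<close> with \<open>p permutes {1..n}\<close>.  Such functions fix every
  number outside \<open>{1..n}\<close>, so \<open>n\<close> has to be passed separately; the group inverse is \<open>inv p\<close>.
\<close>

definition is_peak :: "nat \<Rightarrow> (nat \<Rightarrow> nat) \<Rightarrow> nat \<Rightarrow> bool" where
  "is_peak n p i \<longleftrightarrow> 2 \<le> i \<and> i \<le> n - 1 \<and> p (i - 1) < p i \<and> p i > p (i + 1)"

definition left_peaks :: "nat \<Rightarrow> (nat \<Rightarrow> nat) \<Rightarrow> nat set" where
  "left_peaks n p = {i \<in> {1..n - 1}. is_peak n p i \<or> (i = 1 \<and> p 1 > p 2)}"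

definition lpk :: "nat \<Rightarrow> (nat \<Rightarrow> nat) \<Rightarrow> nat" where
  "lpk n p = card (left_peaks n p)"

definition ilpk :: "nat \<Rightarrow> (nat \<Rightarrow> nat) \<Rightarrow> nat" where
  "ilpk n p = lpk n (inv p)"

text \<open>
  The polynomials are given through their values in an arbitrary commutative ring; indeterminates
  \<open>s\<close>, \<open>t\<close> are the instance where the ring is an extension of the polynomial ring in \<open>s\<close>, \<open>t\<close>.
\<close>

definition P_lpk_ilpk :: "nat \<Rightarrow> 'a::comm_ring_1 \<Rightarrow> 'a \<Rightarrow> 'a" where
  "P_lpk_ilpk n s t = (\<Sum>p | p permutes {1..n}. s ^ lpk n p * t ^ ilpk n p)"

definition P_lpk :: "nat \<Rightarrow> 'a::comm_ring_1 \<Rightarrow> 'a" where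
  "P_lpk n t = (\<Sum>p | p permutes {1..n}. t ^ lpk n p)"

definition L_fps :: "'a::field_char_0 fps" where
  "L_fps = Abs_fps (\<lambda>n. if odd n then 1 / of_nat n else 0)"

lemma L_fps_eq_log:
  "L_fps = fps_const (1 / 2 :: 'a::field_char_0) *
             (fps_ln 1 oo ((1 + fps_X) / (1 - fps_X) - 1))"
  (is "_ = ?R")
proof -
  define q :: "'a fps" where "q = (1 + fps_X) * inverse (1 - fps_X)"
  have q: "(1 + fps_X) / (1 - fps_X) = q"
    by (simp add: q_def fps_divide_unit)
  have q1: "q - 1 = 2 * fps_X * inverse (1 - fps_X)"
  proof -
    have "(1 - fps_X) * inverse (1 - fps_X :: 'a fps) = 1"
      by (simp add: inverse_mult_eq_1')
    thus ?thesis unfolding q_def by algebra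
  qed
  have i: "inverse (1 - fps_X) * (1 - fps_X :: 'a fps) = 1"
    by (simp add: inverse_mult_eq_1)
  have q0: "fps_nth (q - 1) 0 = 0" by (simp add: q1)
  have dq: "fps_deriv (q - 1) = 2 * inverse (1 - fps_X) ^ 2"
    unfolding q_def using i
    by (simp add: fps_inverse_deriv) algebra
  have dln: "fps_deriv (fps_ln 1 oo (q - 1)) = (inverse (1 + fps_X) oo (q - 1)) * fps_deriv (q - 1)"
    using q0 by (simp add: fps_compose_deriv fps_ln_deriv fps_divide_unit)
  have c: "(inverse (1 + fps_X) oo (q - 1)) * q = 1"
  proof -
    have "(inverse (1 + fps_X :: 'a fps) * (1 + fps_X)) oo (q - 1) = 1 oo (q - 1)"
      by (simp add: inverse_mult_eq_1)
    thus ?thesis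
      using q0 by (simp add: fps_compose_mult_distrib fps_compose_add_distrib)
  qed
  have dR: "fps_deriv (fps_ln 1 oo (q - 1)) * (1 - fps_X ^ 2) = 2"
  proof -
    have qq: "q * (1 - fps_X) = 1 + fps_X"
      unfolding q_def using i by algebra
    show ?thesis unfolding dln dq using c qq i by algebra
  qed
  have dL: "fps_deriv L_fps * (1 - fps_X ^ 2) = (1 :: 'a fps)"
  proof (rule fps_ext)
    fix n
    have d: "fps_nth (fps_deriv L_fps) m = (if even m then 1 else 0 :: 'a)" for m
      by (simp add: L_fps_def del: of_nat_Suc)
    have "fps_nth (fps_deriv L_fps * (1 - fps_X ^ 2)) n =
          fps_nth (fps_deriv L_fps) n - (if n < 2 then 0 else fps_nth (fps_deriv L_fps :: 'a fps) (n - 2))"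
      by (simp only: right_diff_distrib fps_sub_nth fps_X_power_mult_right_nth mult_1_right)
    also have "\<dots> = fps_nth 1 n"
      unfolding d by (auto simp: less_2_cases_iff)
    finally show "fps_nth (fps_deriv L_fps * (1 - fps_X ^ 2)) n = fps_nth (1 :: 'a fps) n" .
  qed
  have "fps_deriv (L_fps - ?R) * (1 - fps_X ^ 2) = 0"
  proof -
    have "fps_deriv ?R * (1 - fps_X ^ 2) = fps_const (1/2) * (2 :: 'a fps)"
      unfolding q using dR by (simp add: mult.assoc)
    also have "\<dots> = 1" by (simp add: fps_eq_iff numeral_fps_const)
    finally show ?thesis using dL by (simp only: fps_deriv_sub left_diff_distrib) simp
  qed
  moreover have "1 - fps_X ^ 2 \<noteq> (0 :: 'a fps)"
    by (auto simp: fps_eq_iff intro!: exI[of _ 0])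
  ultimately have "fps_deriv (L_fps - ?R) = 0" by simp
  moreover have "fps_nth (L_fps - ?R) 0 = 0"
    by (simp add: L_fps_def)
  ultimately have "L_fps - ?R = 0" by (metis fps_deriv_eq_0_iff fps_const_0_eq_0)
  thus ?thesis by simp
qed

text \<open>
  \<open>L_quot r\<close> is \<open>L(r u) / r\<close>.  The coefficient of \<open>u\<^sup>n\<close> for odd \<open>n\<close> is \<open>r\<^sup>n\<^sup>-\<^sup>1 / n\<close>; at \<open>r = 0\<close> we take the
  value of this series there, namely \<open>u\<close>, because division by zero in \<open>fps\<close> would yield \<open>0\<close>.
\<close>

definition L_quot :: "'a::field_char_0 \<Rightarrow> 'a fps" where
  "L_quot r = (if r = 0 then fps_X
               else (L_fps oo (fps_const r * fps_X)) / fps_const r)"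

lemma L_quot_nth: "fps_nth (L_quot r) n = (if odd n then r ^ (n - 1) / of_nat n else 0)"
proof (cases "r = 0")
  case True
  thus ?thesis by (auto simp: L_quot_def power_0_left elim!: oddE)
next
  case False
  have "fps_nth (L_quot r) n = r ^ n * fps_nth L_fps n / r"
    using False by (simp add: L_quot_def fps_divide_unit fps_const_inverse fps_compose_linear
        divide_inverse)
  thus ?thesis
    using False by (auto simp: L_fps_def elim!: oddE)
qed

text \<open>
  The square root with constant term \<open>1\<close>: the first argument of \<^const>\<open>fps_radical\<close> supplies the root
  of the constant coefficient, so this is meant for series with constant coefficient \<open>1\<close>.
\<close>

abbreviation fps_sqrt1 :: "'a::field_char_0 fps \<Rightarrow> 'a fps" where
  "fps_sqrt1 f \<equiv> fps_radical (\<lambda>_ _. 1) 2 f"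

end

theory Submission
  imports Defs "HOL-Library.FuncSet"
begin

text \<open>
  For a permutation \<open>p\<close> of \<open>[n]\<close> let \<open>F\<^sub>p(2k+1)\<close> be the number of its left enriched \<open>P\<close>-partitions with
  letters in \<open>{0..2k}\<close>.  Building them up position by position gives
  \<open>\<Sum>\<^sub>k F\<^sub>p(2k+1) x\<^sup>k = v\<^sup>n (1 - v\<^sup>-\<^sup>2)\<^sup>l\<^sup>p\<^sup>k / (1 - x)\<close> with \<open>v = (1 + x)/(1 - x)\<close>, that is,
  \<open>F\<^sub>p = \<Sum>\<^sub>l (-1)\<^sup>l (lpk p choose l) W\<^bsub>n-2l\<^esub>\<close> where \<open>W\<^sub>i\<close> belongs to the identity of \<open>[i]\<close>.

  Standardizing words yields \<open>\<Sum>\<^sub>p F\<^sub>p(M) = M\<^sup>n\<close>, and standardizing pairs of words yields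
  \<open>\<Sum>\<^sub>p F\<^sub>p(M) F\<^bsub>inv p\<^esub>(N) = W\<^sub>n(MN)\<close> for odd \<open>M\<close>, \<open>N\<close>.  On the other hand
  \<open>\<Sum>\<^sub>n W\<^sub>n(N) u\<^sup>n = exp(N L(u)) / sqrt(1 - u\<^sup>2)\<close>, so that \<open>W\<^sub>n(MN) = \<Sum>\<^sub>m d\<^bsub>n,m\<^esub> M\<^sup>m N\<^sup>m\<close> with
  \<open>d\<^bsub>n,m\<^esub>\<close> the coefficient of \<open>u\<^sup>n\<close> in \<open>L(u)\<^sup>m / (m! sqrt(1 - u\<^sup>2))\<close>.

  As the \<open>W\<^sub>i\<close> are linearly independent, there is a linear functional in \<open>M\<close> with
  \<open>W\<^bsub>n-2l\<^esub> \<mapsto> (1 - s)\<^sup>l\<close>.  It sends \<open>F\<^sub>p\<close> to \<open>s\<^sup>l\<^sup>p\<^sup>k\<close> and \<open>M\<^bsup>n-2h\<^esup>\<close> to \<open>(1 - s)\<^sup>h P\<^bsub>n-2h\<^esub>(s)\<close>.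
  Applying it in \<open>M\<close>, and the analogue for \<open>t\<close> in \<open>N\<close>, gives the coefficient of \<open>u\<^sup>n\<close>.
\<close>

section \<open>Counting left enriched P-partitions\<close>

text \<open>
  Here \<open>\<delta> i\<close> says that position \<open>i\<close> is an ascent.  These are the left enriched \<open>P\<close>-partitions of a
  permutation with ascent pattern \<open>\<delta>\<close>: the letters \<open>0 < 1 < 2 < \<dots>\<close> stand for
  \<open>0 < -1 < 1 < -2 < 2 < \<dots>\<close>, and the sign of a letter is read off its parity.
\<close>

definition compat_seqs :: "nat \<Rightarrow> (nat \<Rightarrow> bool) \<Rightarrow> nat \<Rightarrow> (nat \<Rightarrow> nat) set" where
  "compat_seqs n \<delta> m = {a \<in> {1..n} \<rightarrow>\<^sub>E {..<m}.
     \<forall>i\<in>{1..<n}. a i < a (Suc i) \<or> a i = a (Suc i) \<and> (even (a i) \<longleftrightarrow> \<delta> i)}"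

lemma finite_compat_seqs [simp]: "finite (compat_seqs n \<delta> m)"
  unfolding compat_seqs_def
  by (rule finite_subset[of _ "{1..n} \<rightarrow>\<^sub>E {..<m}"]) (auto intro!: finite_PiE)

lemma compat_seqs_0 [simp]: "compat_seqs 0 \<delta> m = {\<lambda>_. undefined}"
  by (auto simp: compat_seqs_def)

lemma compat_seqs_bound_0: "n > 0 \<Longrightarrow> compat_seqs n \<delta> 0 = {}"
  by (auto simp: compat_seqs_def PiE_def Pi_def)

lemma compat_seqs_mono:
  assumes "a \<in> compat_seqs n \<delta> m" "1 \<le> i" "i \<le> j" "j \<le> n"
  shows "a i \<le> a j"
  using \<open>i \<le> j\<close> \<open>1 \<le> i\<close> \<open>j \<le> n\<close>
proof (induction j rule: dec_induct)
  case (step j)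
  have "a j \<le> a (Suc j)"
    using assms(1) step.hyps step.prems unfolding compat_seqs_def
    by (force dest: bspec[of _ _ j])
  thus ?case using step by auto
qed simp

text \<open>Compatible sequences are weakly increasing, so a last letter \<open>x\<close> constrains
  only the entry before it: at most \<open>x\<close> where a tie is allowed, below \<open>x\<close>
  otherwise.\<close>

lemma card_compat_seqs_Suc:
  "card (compat_seqs (Suc n) \<delta> m) =
     (\<Sum>x<m. card (compat_seqs n \<delta> (if even x = \<delta> n then Suc x else x)))"
proof -
  let ?b = "\<lambda>x. if even x = \<delta> n then Suc x else x"
  let ?A = "SIGMA x:{..<m}. compat_seqs n \<delta> (?b x)"
  have "bij_betw (\<lambda>(x, a). a(Suc n := x)) ?A (compat_seqs (Suc n) \<delta> m)"
  proof (rule bij_betwI[where g = "\<lambda>a. (a (Suc n), a(Suc n := undefined))"])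
    show "(\<lambda>(x, a). a(Suc n := x)) \<in> ?A \<rightarrow> compat_seqs (Suc n) \<delta> m"
    proof (clarsimp split del: if_split)
      fix x a assume x: "x < m" and a: "a \<in> compat_seqs n \<delta> (?b x)"
      have lt: "a i < ?b x" if "i \<in> {1..n}" for i
        using a that by (auto simp: compat_seqs_def split del: if_split)
      have "?b x \<le> Suc x" by simp
      hence "a i < m" if "i \<in> {1..n}" for i
        using lt[OF that] x by linarith
      hence "a(Suc n := x) \<in> {1..Suc n} \<rightarrow>\<^sub>E {..<m}"
        using a x by (auto simp: compat_seqs_def PiE_def extensional_def)
      moreover have "(a(Suc n := x)) i < (a(Suc n := x)) (Suc i) \<or>
          (a(Suc n := x)) i = (a(Suc n := x)) (Suc i) \<and> (even ((a(Suc n := x)) i) \<longleftrightarrow> \<delta> i)"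
        if "i \<in> {1..<Suc n}" for i
      proof (cases "i = n")
        case True
        thus ?thesis using lt[of n] that by (auto simp: less_Suc_eq split: if_splits)
      next
        case False
        thus ?thesis using a that by (auto simp: compat_seqs_def)
      qed
      ultimately show "a(Suc n := x) \<in> compat_seqs (Suc n) \<delta> m"
        by (simp add: compat_seqs_def)
    qed
    show "(\<lambda>a. (a (Suc n), a(Suc n := undefined))) \<in> compat_seqs (Suc n) \<delta> m \<rightarrow> ?A"
    proof
      fix a assume a: "a \<in> compat_seqs (Suc n) \<delta> m"
      have "a i < ?b (a (Suc n))" if "i \<in> {1..n}" for i
      proof -
        have "a i \<le> a n" using a that by (intro compat_seqs_mono[OF a]) auto
        moreover have "a n < a (Suc n) \<or> a n = a (Suc n) \<and> (even (a n) \<longleftrightarrow> \<delta> n)"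
          using a that by (auto simp: compat_seqs_def)
        ultimately show ?thesis by auto
      qed
      hence "a(Suc n := undefined) \<in> compat_seqs n \<delta> (?b (a (Suc n)))"
        using a by (auto simp: compat_seqs_def PiE_def extensional_def
            split: if_split)
      moreover have "a (Suc n) < m"
        using a by (auto simp: compat_seqs_def)
      ultimately show "(a (Suc n), a(Suc n := undefined)) \<in> ?A" by simp
    qed
  qed (auto simp: compat_seqs_def PiE_def extensional_def fun_eq_iff)
  from bij_betw_same_card[OF this] show ?thesis by simp
qed

section \<open>Generating functions over odd and even alphabet sizes\<close>

definition odd_gf :: "nat \<Rightarrow> (nat \<Rightarrow> bool) \<Rightarrow> 'a::field_char_0 fps" where
  "odd_gf n \<delta> = Abs_fps (\<lambda>k. of_nat (card (compat_seqs n \<delta> (2 * k + 1))))"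

definition even_gf :: "nat \<Rightarrow> (nat \<Rightarrow> bool) \<Rightarrow> 'a::field_char_0 fps" where
  "even_gf n \<delta> = Abs_fps (\<lambda>k. of_nat (card (compat_seqs n \<delta> (2 * k))))"

lemma fps_eq_telescopeI:
  fixes f g :: "'a::comm_ring_1 fps"
  assumes "fps_nth f 0 = fps_nth g 0"
    and "\<And>k. fps_nth f (Suc k) - fps_nth f k = fps_nth g (Suc k)"
  shows "(1 - fps_X) * f = g"
proof (rule fps_ext)
  fix n show "fps_nth ((1 - fps_X) * f) n = fps_nth g n"
    using assms by (cases n) (auto simp: algebra_simps)
qed

text \<open>In \<open>card_compat_seqs_Suc\<close> an ascent produces only odd bounds and a descent
  only even ones, hence two series. Here the new last letters \<open>2 * k + 1\<close> and
  \<open>2 * k + 2\<close> bring the bounds \<open>2 * k + 1\<close> and \<open>2 * k + 3\<close>,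
  which gives the factor \<open>1 + fps_X\<close>.\<close>

lemma odd_gf_Suc_asc:
  assumes "n = 0 \<or> \<delta> n"
  shows "(1 - fps_X) * odd_gf (Suc n) \<delta> = (1 + fps_X) * (odd_gf n \<delta> :: 'a::field_char_0 fps)"
  by (rule fps_eq_telescopeI)
     (use assms in \<open>auto simp: odd_gf_def card_compat_seqs_Suc algebra_simps numeral_fps_const\<close>)

lemma even_gf_Suc_asc:
  assumes "n = 0 \<or> \<delta> n"
  shows "(1 - fps_X) * even_gf (Suc n) \<delta> = 2 * fps_X * (odd_gf n \<delta> :: 'a::field_char_0 fps)"
  by (rule fps_eq_telescopeI)
     (use assms in \<open>auto simp: odd_gf_def even_gf_def card_compat_seqs_Suc algebra_simps numeral_fps_const\<close>)

text \<open>Both new letters bring the bound \<open>2 * k + 2\<close>, hence the factor 2. The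
  letter 0 brings the bound 0, which admits no sequence of positive length.\<close>

lemma odd_gf_Suc_desc:
  assumes "\<not> \<delta> n" "n > 0"
  shows "(1 - fps_X) * odd_gf (Suc n) \<delta> = 2 * (even_gf n \<delta> :: 'a::field_char_0 fps)"
  by (rule fps_eq_telescopeI)
     (use assms in \<open>auto simp: odd_gf_def even_gf_def card_compat_seqs_Suc compat_seqs_bound_0 algebra_simps numeral_fps_const\<close>)

lemma even_gf_Suc_desc:
  assumes "\<not> \<delta> n" "n > 0"
  shows "(1 - fps_X) * even_gf (Suc n) \<delta> = (1 + fps_X) * (even_gf n \<delta> :: 'a::field_char_0 fps)"
  by (rule fps_eq_telescopeI)
     (use assms in \<open>auto simp: odd_gf_def even_gf_def card_compat_seqs_Suc compat_seqs_bound_0 algebra_simps numeral_fps_const\<close>)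

text \<open>Maximal runs of descents, each counted at its first position.\<close>

definition desc_runs :: "nat \<Rightarrow> (nat \<Rightarrow> bool) \<Rightarrow> nat" where
  "desc_runs n \<delta> = card {i \<in> {1..<n}. \<not> \<delta> i \<and> (i = 1 \<or> \<delta> (i - 1))}"

lemma desc_runs_Suc:
  assumes "n > 0"
  shows "desc_runs (Suc n) \<delta> = desc_runs n \<delta> + (if \<not> \<delta> n \<and> (n = 1 \<or> \<delta> (n - 1)) then 1 else 0)"
proof -
  have "{i \<in> {1..<Suc n}. \<not> \<delta> i \<and> (i = 1 \<or> \<delta> (i - 1))} =
     {i \<in> {1..<n}. \<not> \<delta> i \<and> (i = 1 \<or> \<delta> (i - 1))} \<union> (if \<not> \<delta> n \<and> (n = 1 \<or> \<delta> (n - 1)) then {n} else {})"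
    using assms by (auto simp: less_Suc_eq)
  thus ?thesis by (auto simp: desc_runs_def)
qed

lemma fps_one_minus_X_nonzero: "(1 - fps_X :: 'a::field_char_0 fps) \<noteq> 0"
  by (metis fps_nonzeroI fps_one_nth fps_sub_nth fps_X_nth diff_zero zero_neq_one)

lemma fps_one_plus_X_nonzero: "(1 + fps_X :: 'a::field_char_0 fps) \<noteq> 0"
  by (metis fps_nonzeroI fps_one_nth fps_add_nth fps_X_nth add_0_right zero_neq_one)

text \<open>
  A step from an ascent to a descent multiplies the odd series by \<open>4x/((1 - x)(1 + x))\<close>, every other
  step by \<open>(1 + x)/(1 - x)\<close>; the ratio of the even to the odd series only depends on the last step.
\<close>

lemma odd_gf_invariant:
  assumes "n > 0"
  shows "(odd_gf n \<delta> :: 'a::field_char_0 fps) * (1 - fps_X) ^ Suc n * (1 + fps_X) ^ (2 * desc_runs n \<delta>)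
           = (1 + fps_X) ^ n * (4 * fps_X) ^ desc_runs n \<delta> \<and>
         (if n = 1 \<or> \<delta> (n - 1)
          then (1 + fps_X) * even_gf n \<delta> = 2 * fps_X * (odd_gf n \<delta> :: 'a fps) \<and> 2 * desc_runs n \<delta> < n
          else (1 + fps_X) * odd_gf n \<delta> = 2 * (even_gf n \<delta> :: 'a fps) \<and> 2 * desc_runs n \<delta> \<le> n)"
  using assms
proof (induction n rule: nat_induct_non_zero)
  case 1
  have 0: "(1 - fps_X) * (odd_gf 0 \<delta> :: 'a fps) = 1"
    by (rule fps_eq_telescopeI) (simp_all add: odd_gf_def)
  have E: "(1 - fps_X) * odd_gf 1 \<delta> = (1 + fps_X) * (odd_gf 0 \<delta> :: 'a fps)"
    and V: "(1 - fps_X) * even_gf 1 \<delta> = 2 * fps_X * (odd_gf 0 \<delta> :: 'a fps)"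
    using odd_gf_Suc_asc[of 0 \<delta>] even_gf_Suc_asc[of 0 \<delta>] by simp_all
  note nz = fps_one_minus_X_nonzero[where 'a = 'a]
  have "(1 - fps_X) * ((1 + fps_X) * even_gf 1 \<delta>) =
        (1 - fps_X) * (2 * fps_X * (odd_gf 1 \<delta> :: 'a fps))"
    using E V by algebra
  hence "(1 + fps_X) * even_gf 1 \<delta> = 2 * fps_X * (odd_gf 1 \<delta> :: 'a fps)"
    using nz by simp
  moreover have "desc_runs 1 \<delta> = 0" by (simp add: desc_runs_def)
  moreover have "odd_gf 1 \<delta> * (1 - fps_X) ^ 2 = (1 + fps_X :: 'a fps)"
    using E 0 by algebra
  ultimately show ?case by (simp add: power2_eq_square mult_ac)
next
  case (Suc n)
  define E V E' V' :: "'a fps" where "E = odd_gf n \<delta>" and "V = even_gf n \<delta>"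
    and "E' = odd_gf (Suc n) \<delta>" and "V' = even_gf (Suc n) \<delta>"
  define L where "L = desc_runs n \<delta>"
  define A C :: "'a fps" where "A = 1 - fps_X" and "C = 1 + fps_X"
  have nz: "A \<noteq> 0" unfolding A_def by (rule fps_one_minus_X_nonzero)
  note IH = Suc.IH[folded E_def V_def L_def A_def C_def]
  show ?case unfolding E'_def[symmetric] V'_def[symmetric] A_def[symmetric] C_def[symmetric]
  proof (cases "\<delta> n")
    case True
    have 1: "A * E' = C * E" "A * V' = 2 * fps_X * E"
      using odd_gf_Suc_asc[of n \<delta>, where 'a = 'a] even_gf_Suc_asc[of n \<delta>, where 'a = 'a] True
      by (auto simp: E_def E'_def V'_def A_def C_def)
    have "A * (C * V') = A * (2 * fps_X * E')" using 1 by algebra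
    hence 2: "C * V' = 2 * fps_X * E'" using nz by simp
    have L: "desc_runs (Suc n) \<delta> = L" using True Suc by (simp add: desc_runs_Suc L_def)
    have "E' * A ^ Suc (Suc n) * C ^ (2 * L) = (A * E') * A ^ Suc n * C ^ (2 * L)"
      by (simp add: mult_ac)
    also have "\<dots> = C * (E * A ^ Suc n * C ^ (2 * L))"
      unfolding 1 by (simp add: mult_ac)
    also have "\<dots> = C ^ Suc n * (4 * fps_X) ^ L"
      using IH by (simp add: mult_ac)
    finally have 3: "E' * A ^ Suc (Suc n) * C ^ (2 * L) = C ^ Suc n * (4 * fps_X) ^ L" .
    have "2 * L < Suc n" using IH by (auto split: if_splits)
    then show "E' * A ^ Suc (Suc n) * C ^ (2 * desc_runs (Suc n) \<delta>) = C ^ Suc n * (4 * fps_X) ^ desc_runs (Suc n) \<delta> \<and>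
      (if Suc n = 1 \<or> \<delta> (Suc n - 1) then C * V' = 2 * fps_X * E' \<and> 2 * desc_runs (Suc n) \<delta> < Suc n
       else C * E' = 2 * V' \<and> 2 * desc_runs (Suc n) \<delta> \<le> Suc n)"
      using 2 3 L True by auto
  next
    case False
    have 1: "A * E' = 2 * V" "A * V' = C * V"
      using odd_gf_Suc_desc[of \<delta> n, where 'a = 'a] even_gf_Suc_desc[of \<delta> n, where 'a = 'a] False Suc.hyps
      by (auto simp: V_def E'_def V'_def A_def C_def)
    have "A * (C * E') = A * (2 * V')" using 1 by algebra
    hence 2: "C * E' = 2 * V'" using nz by simp
    define L' where "L' = desc_runs (Suc n) \<delta>"
    have 3: "E' * A ^ Suc (Suc n) * C ^ (2 * L') = C ^ Suc n * (4 * fps_X) ^ L' \<and> 2 * L' \<le> Suc n"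
    proof (cases "n = 1 \<or> \<delta> (n - 1)")
      case True
      hence L': "L' = Suc L" using False Suc by (simp add: desc_runs_Suc L_def L'_def)
      have "C * V = 2 * fps_X * E" using True IH by auto
      hence AC: "A * C * E' = 4 * fps_X * E" using 1 by algebra
      have "E' * A ^ Suc (Suc n) * C ^ (2 * L') = (A * C * E') * A ^ Suc n * C ^ (2 * L) * C"
        by (simp add: mult_ac L')
      also have "\<dots> = 4 * fps_X * C * (E * A ^ Suc n * C ^ (2 * L))"
        unfolding AC by (simp add: mult_ac)
      also have "\<dots> = C ^ Suc n * (4 * fps_X) ^ L'"
        using IH by (simp add: mult_ac L')
      \<comment> \<open>The strict bound available after an ascent pays for the new run.\<close>
      finally show ?thesis using IH True L' by auto
    next
      case F: False
      hence L': "L' = L" using False Suc by (simp add: desc_runs_Suc L_def L'_def)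
      have AE: "A * E' = C * E" using 1 F IH by simp
      have "E' * A ^ Suc (Suc n) * C ^ (2 * L') = (A * E') * A ^ Suc n * C ^ (2 * L)"
        by (simp add: mult_ac L')
      also have "\<dots> = C * (E * A ^ Suc n * C ^ (2 * L))"
        unfolding AE by (simp add: mult_ac)
      also have "\<dots> = C ^ Suc n * (4 * fps_X) ^ L'"
        using IH by (simp add: mult_ac L')
      finally show ?thesis using IH L' F by auto
    qed
    then show "E' * A ^ Suc (Suc n) * C ^ (2 * desc_runs (Suc n) \<delta>) = C ^ Suc n * (4 * fps_X) ^ desc_runs (Suc n) \<delta> \<and>
      (if Suc n = 1 \<or> \<delta> (Suc n - 1) then C * V' = 2 * fps_X * E' \<and> 2 * desc_runs (Suc n) \<delta> < Suc n
       else C * E' = 2 * V' \<and> 2 * desc_runs (Suc n) \<delta> \<le> Suc n)"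
      using 2 False Suc.hyps by (simp add: L'_def)
  qed
qed

lemma two_desc_runs_le: "2 * desc_runs n \<delta> \<le> n"
proof (cases "n = 0")
  case False
  thus ?thesis using odd_gf_invariant[of n \<delta>] by (auto split: if_splits)
qed (simp add: desc_runs_def)

text \<open>Since \<open>4 * fps_X\<close> is a difference of squares, the series is
  \<open>v^(n - 2L) * (v^2 - 1)^L / (1 - x)\<close> with \<open>v = (1 + x)/(1 - x)\<close>, a form
  ready for the binomial theorem.\<close>

lemma odd_gf_closed_form:
  "(odd_gf n \<delta> :: 'a::field_char_0 fps) * (1 - fps_X) ^ Suc n
     = (1 + fps_X) ^ (n - 2 * desc_runs n \<delta>) * ((1 + fps_X) ^ 2 - (1 - fps_X) ^ 2) ^ desc_runs n \<delta>"
proof (cases "n = 0")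
  case True
  have "(1 - fps_X) * (odd_gf 0 \<delta> :: 'a fps) = 1"
    by (rule fps_eq_telescopeI) (simp_all add: odd_gf_def)
  with True show ?thesis by (simp add: desc_runs_def mult_ac)
next
  case False
  define L where "L = desc_runs n \<delta>"
  have L: "2 * L \<le> n" unfolding L_def by (rule two_desc_runs_le)
  have "4 * fps_X = (1 + fps_X) ^ 2 - (1 - fps_X :: 'a fps) ^ 2"
    by (simp add: power2_eq_square algebra_simps)
  hence "(odd_gf n \<delta> :: 'a fps) * (1 - fps_X) ^ Suc n * (1 + fps_X) ^ (2 * L)
     = (1 + fps_X) ^ n * ((1 + fps_X) ^ 2 - (1 - fps_X) ^ 2) ^ L"
    using odd_gf_invariant[of n \<delta>, where 'a = 'a] False by (simp add: L_def)
  also have "(1 + fps_X :: 'a fps) ^ n = (1 + fps_X) ^ (n - 2 * L) * (1 + fps_X) ^ (2 * L)"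
    using L by (simp flip: power_add)
  finally show ?thesis
    using fps_one_plus_X_nonzero[where 'a = 'a] by (simp add: L_def mult_ac)
qed

section \<open>The all-ascending pattern: Delannoy numbers\<close>

definition asc_count :: "nat \<Rightarrow> nat \<Rightarrow> 'a::field_char_0" where
  "asc_count n k = of_nat (card (compat_seqs n (\<lambda>_. True) (2 * k + 1)))"

lemma odd_gf_asc: "(odd_gf n (\<lambda>_. True) :: 'a::field_char_0 fps) * (1 - fps_X) ^ Suc n = (1 + fps_X) ^ n"
  using odd_gf_closed_form[of n "\<lambda>_. True"] by (simp add: desc_runs_def)

text \<open>In the binomial expansion of \<open>odd_gf_closed_form\<close> each term is, up to its
  coefficient, the series of the ascending pattern of length \<open>n - 2 * l\<close>.\<close>

lemma card_compat_seqs_odd: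
  "of_nat (card (compat_seqs n \<delta> (2 * k + 1))) =
     (\<Sum>l\<le>desc_runs n \<delta>. (-1) ^ l * of_nat (desc_runs n \<delta> choose l) * (asc_count (n - 2 * l) k :: 'a::field_char_0))"
proof -
  define L where "L = desc_runs n \<delta>"
  have L: "2 * L \<le> n" unfolding L_def by (rule two_desc_runs_le)
  define A C :: "'a fps" where "A = 1 - fps_X" and "C = 1 + fps_X"
  let ?S = "\<Sum>l\<le>L. fps_const ((-1) ^ l * of_nat (L choose l)) * odd_gf (n - 2 * l) (\<lambda>_. True)"
  have "odd_gf n \<delta> * A ^ Suc n = C ^ (n - 2 * L) * (- (A ^ 2) + C ^ 2) ^ L"
    unfolding A_def C_def L_def by (simp only: odd_gf_closed_form) simp
  also have "\<dots> = (\<Sum>l\<le>L. of_nat (L choose l) * (- (A ^ 2)) ^ l * (C ^ 2) ^ (L - l) * C ^ (n - 2 * L))"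
    by (simp only: binomial_ring sum_distrib_left mult_ac)
  also have "\<dots> = (\<Sum>l\<le>L. fps_const ((-1) ^ l * of_nat (L choose l)) * odd_gf (n - 2 * l) (\<lambda>_. True) * A ^ Suc n)"
  proof (rule sum.cong[OF refl])
    fix l assume "l \<in> {..L}"
    hence l: "2 * l \<le> n" "n - 2 * l = 2 * (L - l) + (n - 2 * L)" "Suc n = Suc (n - 2 * l) + 2 * l"
      using L by auto
    have "odd_gf (n - 2 * l) (\<lambda>_. True) * A ^ Suc n
        = odd_gf (n - 2 * l) (\<lambda>_. True) * A ^ Suc (n - 2 * l) * A ^ (2 * l)"
      by (subst l(3)) (simp only: power_add mult.assoc)
    also have "\<dots> = C ^ (n - 2 * l) * A ^ (2 * l)"
      unfolding A_def C_def by (simp only: odd_gf_asc)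
    finally have *: "odd_gf (n - 2 * l) (\<lambda>_. True) * A ^ Suc n = C ^ (n - 2 * l) * A ^ (2 * l)" .
    have c: "fps_const ((-1) ^ l * of_nat (L choose l)) = (-1) ^ l * (of_nat (L choose l) :: 'a fps)"
      by (simp add: fps_of_nat flip: fps_const_mult fps_const_power fps_const_neg)
    have "of_nat (L choose l) * (- (A ^ 2)) ^ l * (C ^ 2) ^ (L - l) * C ^ (n - 2 * L)
        = (-1) ^ l * of_nat (L choose l) * (C ^ (n - 2 * l) * A ^ (2 * l))"
      unfolding l(2)
      by (simp add: power_minus[of "A ^ 2"] power_add mult_ac flip: power_mult)
    thus "of_nat (L choose l) * (- (A ^ 2)) ^ l * (C ^ 2) ^ (L - l) * C ^ (n - 2 * L)
        = fps_const ((-1) ^ l * of_nat (L choose l)) * odd_gf (n - 2 * l) (\<lambda>_. True) * A ^ Suc n"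
      unfolding c mult.assoc * by simp
  qed
  also have "\<dots> = ?S * A ^ Suc n" by (simp only: sum_distrib_right)
  finally have "odd_gf n \<delta> = (?S :: 'a fps)"
    using fps_one_minus_X_nonzero[where 'a = 'a] by (simp add: A_def)
  from arg_cong[OF this, of "\<lambda>f. fps_nth f k"] show ?thesis
    by (simp add: L_def odd_gf_def asc_count_def fps_sum_nth)
qed

lemma asc_count_0 [simp]: "asc_count 0 k = 1"
  by (simp add: asc_count_def)

lemma asc_count_at_0: "asc_count n 0 = (1 :: 'a::field_char_0)"
proof -
  have "card (compat_seqs n (\<lambda>_. True) (Suc 0)) = 1"
    by (induction n) (simp_all add: card_compat_seqs_Suc)
  thus ?thesis by (simp add: asc_count_def)
qed

text \<open>The Delannoy recurrence, from the two last letters that a larger alphabet adds.\<close>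

lemma asc_count_diff:
  "asc_count (Suc n) (Suc k) - asc_count (Suc n) k = asc_count n (Suc k) + (asc_count n k :: 'a::field_char_0)"
  by (simp add: asc_count_def card_compat_seqs_Suc)

text \<open>The series now runs over the length for a fixed alphabet. The recurrence is symmetric in
  the two indices, so the closed form mirrors \<open>odd_gf_asc\<close>.\<close>

lemma asc_count_gf:
  "(1 - fps_X) ^ Suc k * Abs_fps (\<lambda>n. asc_count n k) = (1 + fps_X :: 'a::field_char_0 fps) ^ k"
proof (induction k)
  case 0
  show ?case
    by (simp, rule fps_eq_telescopeI) (simp_all add: asc_count_at_0)
next
  case (Suc k)
  have "(1 - fps_X) * Abs_fps (\<lambda>n. asc_count n (Suc k)) = (1 + fps_X) * (Abs_fps (\<lambda>n. asc_count n k) :: 'a fps)"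
  proof (rule fps_ext)
    fix n show "fps_nth ((1 - fps_X) * Abs_fps (\<lambda>n. asc_count n (Suc k))) n
               = fps_nth ((1 + fps_X) * Abs_fps (\<lambda>n. asc_count n k) :: 'a fps) n"
      using asc_count_diff[of "n - 1" k, where 'a = 'a]
      by (cases n) (auto simp: algebra_simps)
  qed
  hence "(1 - fps_X) ^ Suc (Suc k) * Abs_fps (\<lambda>n. asc_count n (Suc k))
     = (1 + fps_X) * ((1 - fps_X) ^ Suc k * (Abs_fps (\<lambda>n. asc_count n k) :: 'a fps))"
    by (simp add: mult_ac)
  thus ?case unfolding Suc.IH by simp
qed

section \<open>The exponential form of the counting function\<close>

lemma L_quot_1: "L_quot 1 = L_fps"
  by (rule fps_ext) (simp add: L_quot_nth L_fps_def)

lemma fps_deriv_L_fps: "fps_deriv L_fps * (1 - fps_X ^ 2) = (1 :: 'a::field_char_0 fps)"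
proof (rule fps_ext)
  fix n
  have d: "fps_nth (fps_deriv L_fps) m = (if even m then 1 else 0 :: 'a)" for m
    by (simp add: L_fps_def del: of_nat_Suc)
  have "fps_nth (fps_deriv L_fps * (1 - fps_X ^ 2)) n =
        fps_nth (fps_deriv L_fps) n - (if n < 2 then 0 else fps_nth (fps_deriv L_fps :: 'a fps) (n - 2))"
    by (simp only: right_diff_distrib fps_sub_nth fps_X_power_mult_right_nth mult_1_right)
  also have "\<dots> = fps_nth 1 n"
    unfolding d by (auto simp: less_2_cases_iff)
  finally show "fps_nth (fps_deriv L_fps * (1 - fps_X ^ 2)) n = fps_nth (1 :: 'a fps) n" .
qed

lemma fps_sqrt1_power2:
  assumes "fps_nth f 0 = (1 :: 'a::field_char_0)"
  shows "fps_sqrt1 f ^ 2 = f"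
  using power_radical[of f "\<lambda>_ _. 1" 1] assms by (simp add: numeral_2_eq_2)

text \<open>This is \<open>exp(L(u)) = sqrt((1 + u)/(1 - u))\<close>: the quotient of the two sides
  has derivative 0 and constant term 1.\<close>

lemma fps_exp_L_sqrt:
  fixes Q :: "'a::field_char_0 fps"
  defines "Q \<equiv> fps_sqrt1 (1 - fps_X ^ 2)"
  shows "(fps_exp 1 oo L_fps) * Q = 1 + fps_X"
proof -
  define e :: "'a fps" where "e = fps_exp 1 oo L_fps"
  have L0: "fps_nth L_fps 0 = (0 :: 'a)" by (simp add: L_fps_def)
  have Q2: "Q ^ 2 = 1 - fps_X ^ 2" unfolding Q_def by (rule fps_sqrt1_power2) simp
  have de: "fps_deriv e * (1 - fps_X ^ 2) = e"
    using fps_deriv_L_fps[where 'a = 'a] L0 by (simp add: e_def fps_compose_deriv mult.assoc)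
  have "fps_deriv (Q ^ 2) = - (2 * fps_X)"
    unfolding Q2 by (simp add: fps_deriv_power numeral_fps_const)
  hence "2 * (fps_deriv Q * Q) = 2 * (- fps_X)"
    by (simp add: power2_eq_square mult_ac)
  hence dQ: "fps_deriv Q * Q = - fps_X" by (subst (asm) mult_cancel_left) simp
  have nz: "1 - fps_X ^ 2 \<noteq> (0 :: 'a fps)"
    by (auto simp: fps_eq_iff intro!: exI[of _ 0])
  have "fps_deriv (e * Q * inverse (1 + fps_X)) = 0"
  proof -
    have i: "inverse (1 + fps_X) * (1 + fps_X :: 'a fps) = 1"
      by (simp add: inverse_mult_eq_1)
    define w :: "'a fps" where "w = inverse (1 + fps_X)"
    have i: "(1 - fps_X ^ 2) * w = 1 - fps_X"
      using i unfolding w_def[symmetric] by algebra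
    have d: "fps_deriv (e * Q * w) = fps_deriv e * Q * w + e * fps_deriv Q * w - e * Q * w ^ 2"
      by (simp add: w_def fps_inverse_deriv algebra_simps)
    \<comment> \<open>The nonzero factor \<open>(1 - fps_X ^ 2) * Q\<close> clears denominators, so
      that \<open>de\<close>, \<open>dQ\<close>, \<open>Q2\<close> and \<open>i\<close>
      apply.\<close>
    have "(1 - fps_X ^ 2) * Q * fps_deriv (e * Q * w) =
        (fps_deriv e * (1 - fps_X ^ 2)) * Q ^ 2 * w + e * (fps_deriv Q * Q) * ((1 - fps_X ^ 2) * w)
        - e * Q ^ 2 * ((1 - fps_X ^ 2) * w) * w"
      unfolding d by (simp add: power2_eq_square algebra_simps)
    also have "\<dots> = e * ((1 - fps_X ^ 2) * w) + e * (- fps_X) * ((1 - fps_X ^ 2) * w)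
        - e * ((1 - fps_X ^ 2) * w) * ((1 - fps_X ^ 2) * w)"
      unfolding de dQ Q2 by (simp add: mult_ac)
    also have "\<dots> = 0" unfolding i by (simp add: algebra_simps)
    finally have "(1 - fps_X ^ 2) * Q * fps_deriv (e * Q * inverse (1 + fps_X)) = 0"
      by (simp only: w_def)
    moreover have "Q \<noteq> 0" using Q2 nz by auto
    ultimately show ?thesis using nz by simp
  qed
  then obtain c where c: "e * Q * inverse (1 + fps_X) = fps_const c"
    by (metis fps_deriv_eq_0_iff)
  from arg_cong[OF this, of "\<lambda>f. fps_nth f 0"] have "c = 1"
    by (simp add: e_def Q_def)
  with c have "e * Q * (inverse (1 + fps_X) * (1 + fps_X)) = 1 + fps_X"
    by (metis fps_const_1_eq_1 mult.assoc mult_1)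
  thus ?thesis by (simp add: e_def inverse_mult_eq_1)
qed

text \<open>For \<open>r = 1\<close> these are the numbers \<open>d\<close> of the overview; general
  \<open>r\<close> gives the coefficients on the right-hand side of the theorem.\<close>

definition gf_coeff :: "'a::field_char_0 \<Rightarrow> nat \<Rightarrow> nat \<Rightarrow> 'a" where
  "gf_coeff r n m = fps_nth (inverse (fps_sqrt1 (1 - fps_const (r ^ 2) * fps_X ^ 2)) * L_quot r ^ m) n / fact m"

text \<open>With \<open>e = exp(L(u))\<close> one has \<open>e^2 = (1 + u)/(1 - u)\<close> and
  \<open>e * (1 - u) = Q\<close>, so \<open>asc_count_gf\<close> becomes
  \<open>e^(2k + 1) / Q\<close>; expanding \<open>exp((2k + 1) L(u))\<close> in powers of
  \<open>L\<close> gives the sum.\<close>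

lemma asc_count_expand:
  "asc_count n k = (\<Sum>m\<le>n. gf_coeff 1 n m * (of_nat (2 * k + 1) :: 'a::field_char_0) ^ m)"
proof -
  define Q :: "'a fps" where "Q = fps_sqrt1 (1 - fps_X ^ 2)"
  define e :: "'a fps" where "e = fps_exp 1 oo L_fps"
  define G :: "'a fps" where "G = Abs_fps (\<lambda>n. asc_count n k)"
  have L0: "fps_nth L_fps 0 = (0 :: 'a)" by (simp add: L_fps_def)
  have Q2: "Q ^ 2 = (1 - fps_X) * (1 + fps_X)" unfolding Q_def
    by (subst fps_sqrt1_power2) (simp_all add: algebra_simps power2_eq_square)
  have Qinv: "inverse Q * Q = 1" by (rule inverse_mult_eq_1) (simp add: Q_def)
  have eQ: "e * Q = 1 + fps_X" unfolding e_def Q_def by (rule fps_exp_L_sqrt)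
  have "(1 + fps_X) * (e * (1 - fps_X)) = (1 + fps_X) * Q" using eQ Q2 by algebra
  hence eA: "e * (1 - fps_X) = Q" using fps_one_plus_X_nonzero[where 'a = 'a] by simp
  have e2: "e ^ 2 * (1 - fps_X) = 1 + fps_X"
    using eA eQ by (simp add: power2_eq_square mult.assoc)
  have "(1 - fps_X) ^ Suc k * (G * Q) = (1 + fps_X) ^ k * Q"
    using asc_count_gf[of k, where 'a = 'a] unfolding G_def by (metis mult.assoc)
  also have "\<dots> = (e ^ 2 * (1 - fps_X)) ^ k * (e * (1 - fps_X))"
    by (simp only: e2 eA)
  also have "\<dots> = (1 - fps_X) ^ Suc k * e ^ (2 * k + 1)"
    by (simp add: power_mult_distrib mult_ac flip: power_mult)
  finally have "G * Q = e ^ (2 * k + 1)"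
    using fps_one_minus_X_nonzero[where 'a = 'a] by (metis mult_left_cancel power_not_zero)
  hence "G = inverse Q * e ^ (2 * k + 1)" using Qinv by (metis mult.assoc mult.commute mult_1_right)
  also have "e ^ (2 * k + 1) = fps_exp (of_nat (2 * k + 1)) oo L_fps"
    unfolding e_def using L0 by (simp only: fps_compose_power fps_exp_power_mult mult_1_right)
  finally have G: "G = inverse Q * (fps_exp (of_nat (2 * k + 1)) oo L_fps)" .
  let ?c = "of_nat (2 * k + 1) :: 'a"
  have "asc_count n k = (\<Sum>i=0..n. fps_nth (inverse Q) i * (\<Sum>m=0..n-i. ?c ^ m / fact m * fps_nth (L_fps ^ m) (n - i)))"
    using arg_cong[OF G, of "\<lambda>f. fps_nth f n"]
    by (simp only: G_def fps_nth_Abs_fps fps_mult_nth fps_compose_nth fps_exp_nth of_nat_fact)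
  \<comment> \<open>\<open>L_fps ^ m\<close> starts in degree \<open>m\<close>, so the added terms
    vanish; the range no longer depends on \<open>i\<close> and the sums can be swapped.\<close>
  also have "\<dots> = (\<Sum>i=0..n. fps_nth (inverse Q) i * (\<Sum>m\<le>n. ?c ^ m / fact m * fps_nth (L_fps ^ m) (n - i)))"
    using L0 by (intro sum.cong arg_cong2[where f = "(*)"] sum.mono_neutral_left refl)
      (auto simp: startsby_zero_power_prefix)
  also have "\<dots> = (\<Sum>m\<le>n. \<Sum>i=0..n. fps_nth (inverse Q) i * (?c ^ m / fact m * fps_nth (L_fps ^ m) (n - i)))"
    by (subst sum.swap) (simp only: sum_distrib_left)
  also have "\<dots> = (\<Sum>m\<le>n. gf_coeff 1 n m * ?c ^ m)"
    unfolding gf_coeff_def L_quot_1 Q_def power_one fps_const_1_eq_1 mult_1_left fps_mult_nth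
      sum_divide_distrib sum_distrib_right
    by (intro sum.cong refl) simp
  finally show ?thesis .
qed

text \<open>The relation \<open>f(u) = F(r u) / r^a\<close> is stated coefficientwise to cover
  \<open>r = 0\<close>. Vanishing below degree \<open>a\<close> takes care of truncated
  subtraction.\<close>

lemma fps_scaling_mult:
  fixes f g F G :: "'a::field_char_0 fps"
  assumes "\<And>n. fps_nth f n = r ^ (n - a) * fps_nth F n" "\<And>n. n < a \<Longrightarrow> fps_nth F n = 0"
    and "\<And>n. fps_nth g n = r ^ (n - b) * fps_nth G n" "\<And>n. n < b \<Longrightarrow> fps_nth G n = 0"
  shows "fps_nth (f * g) n = r ^ (n - (a + b)) * fps_nth (F * G) n"
  unfolding fps_mult_nth sum_distrib_left
proof (rule sum.cong[OF refl])
  fix i assume i: "i \<in> {0..n}"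
  show "fps_nth f i * fps_nth g (n - i) = r ^ (n - (a + b)) * (fps_nth F i * fps_nth G (n - i))"
  proof (cases "i < a \<or> n - i < b")
    case True
    thus ?thesis using assms by auto
  next
    case False
    hence "n - (a + b) = (i - a) + (n - i - b)" using i by auto
    thus ?thesis by (simp add: assms(1,3) power_add mult_ac)
  qed
qed

lemma L_quot_power_scaling:
  fixes r :: "'a::field_char_0"
  shows "fps_nth (L_quot r ^ m) n = r ^ (n - m) * fps_nth (L_quot 1 ^ m) n \<and>
   (n < m \<longrightarrow> fps_nth (L_quot (1::'a::field_char_0) ^ m) n = 0)"
proof (induction m arbitrary: n)
  case 0
  show ?case by simp
next
  case (Suc m)
  have "fps_nth (L_quot r * L_quot r ^ m) n = r ^ (n - (1 + m)) * fps_nth (L_quot 1 * L_quot 1 ^ m) n"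
    by (rule fps_scaling_mult) (use Suc.IH in \<open>auto simp: L_quot_nth\<close>)
  moreover have "fps_nth (L_quot (1::'a)) 0 = 0" by (simp add: L_quot_nth)
  ultimately show ?case by (simp add: startsby_zero_power_prefix del: power_Suc) simp
qed

lemma fps_sqrt1_scaling:
  "fps_nth (inverse (fps_sqrt1 (1 - fps_const (r ^ 2) * fps_X ^ 2))) n
     = r ^ n * fps_nth (inverse (fps_sqrt1 (1 - fps_X ^ 2))) (n :: nat)" for r :: "'a::field_char_0"
proof -
  let ?h = "fps_const r * fps_X"
  have "inverse (fps_sqrt1 (1 - fps_X ^ 2)) oo ?h = inverse (fps_sqrt1 (1 - fps_X ^ 2) oo ?h)"
    by (rule fps_inverse_compose) auto
  also have "fps_sqrt1 (1 - fps_X ^ 2) oo ?h = fps_sqrt1 ((1 - fps_X ^ 2) oo ?h)"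
    using fps_compose_radical[of ?h "\<lambda>_ _. 1" 1 "1 - fps_X ^ 2"] by (simp add: numeral_2_eq_2)
  also have "(1 - fps_X ^ 2) oo ?h = 1 - fps_const (r ^ 2) * fps_X ^ 2"
    by (simp add: fps_compose_sub_distrib fps_compose_power[symmetric] power_mult_distrib fps_const_power)
  finally have "fps_nth (inverse (fps_sqrt1 (1 - fps_X ^ 2)) oo ?h) n
      = fps_nth (inverse (fps_sqrt1 (1 - fps_const (r ^ 2) * fps_X ^ 2))) n" by (rule arg_cong)
  thus ?thesis by (simp only: fps_compose_linear fps_nth_Abs_fps)
qed

text \<open>Isolates the dependence on \<open>r\<close>: the combinatorics only produces the case
  \<open>r = 1\<close>.\<close>

lemma gf_coeff_scaling: "gf_coeff r n m = r ^ (n - m) * gf_coeff 1 n m"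
proof -
  have "fps_nth (inverse (fps_sqrt1 (1 - fps_const (r ^ 2) * fps_X ^ 2)) * L_quot r ^ m) n
     = r ^ (n - (0 + m)) * fps_nth (inverse (fps_sqrt1 (1 - fps_X ^ 2)) * L_quot 1 ^ m) n"
    by (rule fps_scaling_mult) (use L_quot_power_scaling fps_sqrt1_scaling in auto)
  thus ?thesis by (simp add: gf_coeff_def)
qed

text \<open>\<open>L\<close> is odd, so \<open>r = -1\<close> and \<open>r = 1\<close> give the same
  series, whereas scaling gives opposite coefficients.\<close>

lemma gf_coeff_odd:
  assumes "odd (n - m)"
  shows "gf_coeff r n m = (0 :: 'a::field_char_0)"
proof -
  have "L_quot (-1) = (L_quot 1 :: 'a fps)"
    by (rule fps_ext) (auto simp: L_quot_nth elim!: oddE)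
  hence "gf_coeff (-1) n m = (gf_coeff 1 n m :: 'a)" by (simp add: gf_coeff_def)
  hence "gf_coeff 1 n m = (0 :: 'a)"
    using gf_coeff_scaling[of "-1 :: 'a" n m] assms by simp
  thus ?thesis by (subst gf_coeff_scaling) simp
qed

section \<open>Standardization\<close>

definition asc :: "(nat \<Rightarrow> nat) \<Rightarrow> nat \<Rightarrow> bool" where
  "asc p i \<longleftrightarrow> p i < p (Suc i)"

text \<open>A left peak is where a maximal run of descents begins; by injectivity every non-ascent
  is a descent.\<close>

lemma lpk_eq_desc_runs:
  assumes "inj p"
  shows "lpk n p = desc_runs n (asc p)"
proof -
  have neq: "p (Suc i) < p i \<longleftrightarrow> \<not> p i < p (Suc i)" for i
    using injD[OF assms, of i "Suc i"] by (metis n_not_Suc_n nat_neq_iff less_asym)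
  have "left_peaks n p = {i \<in> {1..<n}. \<not> asc p i \<and> (i = 1 \<or> asc p (i - 1))}"
  proof (rule set_eqI)
    fix i
    show "i \<in> left_peaks n p \<longleftrightarrow> i \<in> {i \<in> {1..<n}. \<not> asc p i \<and> (i = 1 \<or> asc p (i - 1))}"
    proof (cases "i = 0 \<or> i = 1")
      case True
      thus ?thesis using neq[of 1]
        by (auto simp: left_peaks_def is_peak_def asc_def numeral_2_eq_2)
    next
      case False
      then obtain j where j: "i = Suc (Suc j)" by (metis One_nat_def not0_implies_Suc)
      show ?thesis using neq[of i] unfolding j
        by (auto simp: left_peaks_def is_peak_def asc_def)
    qed
  qed
  thus ?thesis by (simp add: lpk_def desc_runs_def)
qed

text \<open>The order of positions in the standardization of the word \<open>w\<close>.\<close>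

definition std_less :: "(nat \<Rightarrow> nat) \<Rightarrow> nat \<Rightarrow> nat \<Rightarrow> bool" where
  "std_less w i j \<longleftrightarrow> w i < w j \<or> w i = w j \<and> (if even (w i) then i < j else j < i)"

lemma std_less_trans: "std_less w i j \<Longrightarrow> std_less w j k \<Longrightarrow> std_less w i k"
  by (auto simp: std_less_def split: if_splits)

lemma std_less_irrefl [simp]: "\<not> std_less w i i"
  by (simp add: std_less_def)

lemma std_less_total: "i \<noteq> j \<Longrightarrow> std_less w i j \<or> std_less w j i"
  by (auto simp: std_less_def)

definition words :: "nat \<Rightarrow> nat \<Rightarrow> (nat \<Rightarrow> nat) set" where
  "words n m = {1..n} \<rightarrow>\<^sub>E {..<m}"

text \<open>The words whose standardization is \<open>p\<close>.\<close>

definition std_class :: "nat \<Rightarrow> (nat \<Rightarrow> nat) \<Rightarrow> nat \<Rightarrow> (nat \<Rightarrow> nat) set" where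
  "std_class n p m = {w \<in> words n m. \<forall>i\<in>{1..n}. \<forall>j\<in>{1..n}. p i < p j \<longleftrightarrow> std_less w i j}"

lemma finite_words [simp]: "finite (words n m)"
  by (auto simp: words_def intro!: finite_PiE)

lemma card_words: "card (words n m) = m ^ n"
  by (simp add: words_def card_PiE)

lemma finite_std_class [simp]: "finite (std_class n p m)"
  by (rule finite_subset[of _ "words n m"]) (auto simp: std_class_def)

text \<open>A value is its rank, so a permutation is determined by the order it induces on
  positions; this makes the classes disjoint.\<close>

lemma permutes_value_eq_card:
  assumes "p permutes {1..n}" "i \<in> {1..n}"
  shows "p i = Suc (card {j \<in> {1..n}. p j < p i})"
proof -
  have pi: "p i \<in> {1..n}" using assms permutes_in_image by metis
  have "p ` {j \<in> {1..n}. p j < p i} = {1..<p i}"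
  proof
    show "p ` {j \<in> {1..n}. p j < p i} \<subseteq> {1..<p i}"
      using permutes_in_image[OF assms(1)] by fastforce
    show "{1..<p i} \<subseteq> p ` {j \<in> {1..n}. p j < p i}"
    proof
      fix y assume y: "y \<in> {1..<p i}"
      hence "y \<in> p ` {1..n}" using pi permutes_image[OF assms(1)] by auto
      thus "y \<in> p ` {j \<in> {1..n}. p j < p i}" using y by auto
    qed
  qed
  moreover have "inj_on p {j \<in> {1..n}. p j < p i}"
    using permutes_inj[OF assms(1)] by (auto intro: inj_on_subset)
  ultimately have "card {j \<in> {1..n}. p j < p i} = p i - 1"
    using card_image by fastforce
  thus ?thesis using pi by simp
qed

lemma std_class_disjoint:
  assumes "p permutes {1..n}" "q permutes {1..n}" "w \<in> std_class n p m" "w \<in> std_class n q m"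
  shows "p = q"
proof
  fix i
  show "p i = q i"
  proof (cases "i \<in> {1..n}")
    case True
    have "{j \<in> {1..n}. p j < p i} = {j \<in> {1..n}. q j < q i}"
      using assms(3,4) True by (auto simp: std_class_def)
    thus ?thesis
      using permutes_value_eq_card[OF assms(1) True] permutes_value_eq_card[OF assms(2) True] by simp
  next
    case False
    thus ?thesis using assms(1,2) by (simp add: permutes_not_in)
  qed
qed

text \<open>The standardization ranks each position in the strict total order
  \<open>std_less w\<close>.\<close>

lemma std_class_exists:
  assumes "w \<in> words n m"
  shows "\<exists>p. p permutes {1..n} \<and> w \<in> std_class n p m"
proof -
  define p where "p i = (if i \<in> {1..n} then Suc (card {j \<in> {1..n}. std_less w j i}) else i)" for i
  have mono: "p i < p j" if "i \<in> {1..n}" "j \<in> {1..n}" "std_less w i j" for i j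
  proof -
    have "{k \<in> {1..n}. std_less w k i} \<subset> {k \<in> {1..n}. std_less w k j}"
    proof (rule psubsetI)
      show "{k \<in> {1..n}. std_less w k i} \<subseteq> {k \<in> {1..n}. std_less w k j}"
        using that std_less_trans[of w _ i j] by auto
      have "i \<in> {k \<in> {1..n}. std_less w k j} - {k \<in> {1..n}. std_less w k i}"
        using that by simp
      thus "{k \<in> {1..n}. std_less w k i} \<noteq> {k \<in> {1..n}. std_less w k j}" by blast
    qed
    hence "card {k \<in> {1..n}. std_less w k i} < card {k \<in> {1..n}. std_less w k j}"
      by (intro psubset_card_mono) auto
    thus ?thesis using that by (simp add: p_def)
  qed
  have iff: "p i < p j \<longleftrightarrow> std_less w i j" if "i \<in> {1..n}" "j \<in> {1..n}" for i j
    using mono[OF that] mono[OF that(2,1)] std_less_total[of i j w] by (cases "i = j") fastforce+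
  have inj: "inj_on p {1..n}"
    by (rule inj_onI) (metis iff nat_neq_iff std_less_total)
  have "p i \<in> {1..n}" if "i \<in> {1..n}" for i
  proof -
    have "{j \<in> {1..n}. std_less w j i} \<subset> {1..n}" using that std_less_irrefl[of w i] by blast
    hence "card {j \<in> {1..n}. std_less w j i} < n"
      by (metis card_atLeastAtMost diff_Suc_1 finite_atLeastAtMost psubset_card_mono)
    thus ?thesis using that by (simp add: p_def)
  qed
  hence "p ` {1..n} = {1..n}" using inj by (intro endo_inj_surj) auto
  hence "bij_betw p {1..n} {1..n}" using inj by (simp add: bij_betw_def)
  hence "p permutes {1..n}" by (rule bij_imp_permutes) (auto simp: p_def)
  moreover have "w \<in> std_class n p m" using assms iff by (simp add: std_class_def)
  ultimately show ?thesis by blast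
qed

lemma words_eq_UN_std_class: "words n m = (\<Union>p\<in>{p. p permutes {1..n}}. std_class n p m)"
  using std_class_exists by (auto simp: std_class_def)

section \<open>Compatible sequences as sorted words\<close>

lemma chain_transp:
  fixes i j :: nat
  assumes "\<And>i. 1 \<le> i \<Longrightarrow> i < n \<Longrightarrow> R i (Suc i)" "\<And>i j k. R i j \<Longrightarrow> R j k \<Longrightarrow> R i k"
    and "1 \<le> i" "i < j" "j \<le> n"
  shows "R i j"
  using assms(4,3,5)
proof (induction i j rule: less_Suc_induct)
  case (1 i)
  thus ?case using assms(1) by simp
next
  case (2 i j k)
  thus ?case using assms(2)[of i j k] by simp
qed

text \<open>The condition on neighbours is a transitive relation, hence holds for all pairs. The
  pairwise form can be matched with \<open>std_less\<close>.\<close>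

lemma compat_seqs_iff_pairs:
  assumes "inj_on p {1..n}"
  shows "a \<in> compat_seqs n (asc p) m \<longleftrightarrow> a \<in> words n m \<and>
    (\<forall>i\<in>{1..n}. \<forall>j\<in>{1..n}. i < j \<longrightarrow> a i < a j \<or> a i = a j \<and> (if even (a i) then p i < p j else p j < p i))"
    (is "_ \<longleftrightarrow> _ \<and> ?P")
proof
  let ?R = "\<lambda>i j. a i < a j \<or> a i = a j \<and> (if even (a i) then p i < p j else p j < p i)"
  assume a: "a \<in> compat_seqs n (asc p) m"
  have 1: "?R i (Suc i)" if "1 \<le> i" "i < n" for i
  proof -
    have "p i \<noteq> p (Suc i)" using inj_onD[OF assms, of i "Suc i"] that by auto
    moreover have "a i < a (Suc i) \<or> a i = a (Suc i) \<and> (even (a i) \<longleftrightarrow> asc p i)"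
      using a that by (auto simp: compat_seqs_def)
    ultimately show ?thesis by (auto simp: asc_def)
  qed
  have "?R i j" if "i \<in> {1..n}" "j \<in> {1..n}" "i < j" for i j
    by (rule chain_transp[of n ?R]) (use 1 that in \<open>auto split: if_splits\<close>)
  moreover have "a \<in> words n m" using a by (simp add: compat_seqs_def words_def)
  ultimately show "a \<in> words n m \<and> ?P" by blast
next
  assume a: "a \<in> words n m \<and> ?P"
  have "a i < a (Suc i) \<or> a i = a (Suc i) \<and> (even (a i) \<longleftrightarrow> asc p i)" if "i \<in> {1..<n}" for i
  proof -
    have "i \<in> {1..n}" "Suc i \<in> {1..n}" "i < Suc i" using that by auto
    with a show ?thesis unfolding asc_def by (smt (verit) less_asym)
  qed
  thus "a \<in> compat_seqs n (asc p) m" using a by (auto simp: compat_seqs_def words_def)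
qed

text \<open>Composing a word with \<open>inv p\<close> sorts it. Equal even letters are then read
  from left to right and equal odd ones from right to left, which is compatibility with
  \<open>inv p\<close>.\<close>

lemma card_std_class:
  assumes "p permutes {1..n}"
  shows "card (std_class n p m) = card (compat_seqs n (asc (inv p)) m)"
proof -
  have q: "inv p permutes {1..n}" using assms by (rule permutes_inv)
  have pq: "p (inv p i) = i" "inv p (p i) = i" for i using permutes_inverses[OF assms] by auto
  have pin: "p i \<in> {1..n} \<longleftrightarrow> i \<in> {1..n}" "inv p i \<in> {1..n} \<longleftrightarrow> i \<in> {1..n}" for i
    using permutes_in_image[OF assms] permutes_in_image[OF q] by auto
  have injq: "inj_on (inv p) {1..n}" using permutes_inj[OF q] by (rule inj_on_subset) simp
  have wo: "w \<circ> f \<in> words n m" if "w \<in> words n m" "\<And>i. f i \<in> {1..n} \<longleftrightarrow> i \<in> {1..n}" for w f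
    using that by (auto simp: words_def PiE_def Pi_def extensional_def)
  have "bij_betw (\<lambda>w. w \<circ> inv p) (std_class n p m) (compat_seqs n (asc (inv p)) m)"
  proof (rule bij_betwI[where g = "\<lambda>b. b \<circ> p"])
    show "(\<lambda>w. w \<circ> inv p) \<in> std_class n p m \<rightarrow> compat_seqs n (asc (inv p)) m"
    proof
      fix w assume w: "w \<in> std_class n p m"
      have "std_less w (inv p i) (inv p j)" if "i \<in> {1..n}" "j \<in> {1..n}" "i < j" for i j
        using w that pin(2) pq(1) unfolding std_class_def by force
      thus "w \<circ> inv p \<in> compat_seqs n (asc (inv p)) m"
        unfolding compat_seqs_iff_pairs[OF injq]
        using w wo[of w "inv p"] pin(2) by (auto simp: std_class_def std_less_def)
    qed
    show "(\<lambda>b. b \<circ> p) \<in> compat_seqs n (asc (inv p)) m \<rightarrow> std_class n p m"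
    proof
      fix b assume "b \<in> compat_seqs n (asc (inv p)) m"
      note b' = this[unfolded compat_seqs_iff_pairs[OF injq]]
      hence b: "b \<in> words n m" by blast
      have R: "b i < b j \<or> b i = b j \<and> (if even (b i) then inv p i < inv p j else inv p j < inv p i)"
          if "i \<in> {1..n}" "j \<in> {1..n}" "i < j" for i j
        using b' that by blast
      have 1: "std_less (b \<circ> p) i j" if "i \<in> {1..n}" "j \<in> {1..n}" "p i < p j" for i j
        using R[of "p i" "p j"] that pin(1)[of i] pin(1)[of j] unfolding std_less_def pq(2) comp_apply
        by blast
      \<comment> \<open>The converse follows from trichotomy of \<open>p i\<close>,
        \<open>p j\<close> and asymmetry of \<open>std_less\<close>.\<close>
      have "p i < p j \<longleftrightarrow> std_less (b \<circ> p) i j" if "i \<in> {1..n}" "j \<in> {1..n}" for i j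
        using 1[OF that] 1[OF that(2,1)] std_less_trans[of "b \<circ> p" i j i] pq(2)
        by (metis nat_neq_iff std_less_irrefl)
      thus "b \<circ> p \<in> std_class n p m"
        using wo[OF b, of p] pin(1) by (simp add: std_class_def)
    qed
  qed (auto simp: fun_eq_iff pq)
  thus ?thesis by (rule bij_betw_same_card)
qed

lemma sum_permutes_inv:
  "(\<Sum>p | p permutes S. f (inv p)) = (\<Sum>p | p permutes S. f p)" 
  by (rule sum.reindex_bij_witness[where i = inv and j = inv])
     (auto simp: permutes_inv permutes_inv_inv)

text \<open>Every word lies in exactly one standardization class.\<close>

lemma sum_card_compat_seqs:
  "(\<Sum>p | p permutes {1..n}. card (compat_seqs n (asc p) m)) = m ^ n"
proof -
  have "(\<Sum>p | p permutes {1..n}. card (compat_seqs n (asc p) m))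
      = (\<Sum>p | p permutes {1..n}. card (compat_seqs n (asc (inv p)) m))"
    by (rule sum_permutes_inv[symmetric])
  also have "\<dots> = (\<Sum>p | p permutes {1..n}. card (std_class n p m))"
    by (rule sum.cong) (simp_all add: card_std_class)
  also have "\<dots> = card (words n m)"
    unfolding words_eq_UN_std_class
    by (rule card_UN_disjoint[symmetric])
       (use std_class_disjoint in \<open>auto simp: finite_permutations\<close>)
  finally show ?thesis by (simp add: card_words)
qed

section \<open>Pairs of words as words over a product alphabet\<close>

text \<open>
  The boustrophedon enumeration of a rectangle.  For an odd row length \<open>m\<close> the parity of the index of
  \<open>(x, y)\<close> is that of \<open>x + y\<close>, so it carries the tie-breaking rules for pairs of letters to those
  for a single letter.
\<close>

definition snake :: "nat \<Rightarrow> nat \<Rightarrow> nat \<Rightarrow> nat" where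
  "snake m x y = x * m + (if even x then y else m - 1 - y)"

lemma snake_bij:
  "bij_betw (\<lambda>(x, y). snake m x y) ({..<l} \<times> {..<m}) {..<l * m}"
proof (rule bij_betwI[where g = "\<lambda>z. (z div m, if even (z div m) then z mod m else m - 1 - z mod m)"])
  show "(\<lambda>(x, y). snake m x y) \<in> {..<l} \<times> {..<m} \<rightarrow> {..<l * m}"
  proof clarsimp
    fix x y assume "x < l" "y < m"
    hence "snake m x y < Suc x * m" by (auto simp: snake_def)
    also have "\<dots> \<le> l * m" using \<open>x < l\<close> by (intro mult_right_mono) auto
    finally show "snake m x y < l * m" .
  qed
  show "(\<lambda>z. (z div m, if even (z div m) then z mod m else m - 1 - z mod m)) \<in> {..<l * m} \<rightarrow> {..<l} \<times> {..<m}"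
  proof
    fix z assume "z \<in> {..<l * m}"
    hence "z < l * m" "m > 0" by (auto intro: Nat.gr0I)
    thus "(z div m, if even (z div m) then z mod m else m - 1 - z mod m) \<in> {..<l} \<times> {..<m}"
      by (auto simp: less_mult_imp_div_less)
  qed
next
  fix xy assume "xy \<in> {..<l} \<times> {..<m}"
  then obtain x y where xy: "xy = (x, y)" "x < l" "y < m" by auto
  define y' where "y' = (if even x then y else m - 1 - y)"
  have "y' < m" using xy by (auto simp: y'_def)
  hence "snake m x y div m = x" "snake m x y mod m = y'"
    by (simp_all add: snake_def flip: y'_def)
  thus "((case xy of (x, y) \<Rightarrow> snake m x y) div m,
      if even ((case xy of (x, y) \<Rightarrow> snake m x y) div m) then (case xy of (x, y) \<Rightarrow> snake m x y) mod m
      else m - 1 - (case xy of (x, y) \<Rightarrow> snake m x y) mod m) = xy"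
    using xy by (simp add: y'_def)
next
  fix z assume "z \<in> {..<l * m}"
  hence "m > 0" by (auto intro: Nat.gr0I)
  hence "m - 1 - (m - 1 - z mod m) = z mod m"
    using mod_less_divisor[of m z] by linarith
  thus "(case (z div m, if even (z div m) then z mod m else m - 1 - z mod m) of (x, y) \<Rightarrow> snake m x y) = z"
    by (simp add: snake_def)
qed

lemma snake_less_iff:
  assumes "y < m" "y' < m"
  shows "snake m x y < snake m x' y' \<longleftrightarrow> x < x' \<or> x = x' \<and> (if even x then y < y' else y' < y)"
proof -
  have lt: "snake m x y < snake m x' y'" if "x < x'" "y < m" for x x' y y'
  proof -
    have "snake m x y < Suc x * m" using that by (auto simp: snake_def)
    also have "\<dots> \<le> x' * m" using that by (intro mult_right_mono) auto
    also have "\<dots> \<le> snake m x' y'" by (simp add: snake_def)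
    finally show ?thesis .
  qed
  show ?thesis
    using lt[of x x' y y'] lt[of x' x y' y] assms
    by (cases x x' rule: linorder_cases) (auto simp: snake_def)
qed

text \<open>For odd \<open>m\<close>, \<open>x * m\<close> has the parity of \<open>x\<close> and
  \<open>m - 1 - y\<close> that of \<open>y\<close>.\<close>

lemma even_snake_iff:
  assumes "odd m" "y < m"
  shows "even (snake m x y) \<longleftrightarrow> even (x + y)"
  using assms by (auto simp: snake_def)

lemma snake_inj:
  assumes "y < m" "y' < m" "snake m x y = snake m x' y'"
  shows "x = x' \<and> y = y'"
  using snake_less_iff[OF assms(1,2), of x x'] snake_less_iff[OF assms(2,1), of x' x] assms(3)
  by (cases x x' rule: linorder_cases; cases y y' rule: linorder_cases) (auto split: if_splits)

definition snake_word :: "nat \<Rightarrow> nat \<Rightarrow> (nat \<Rightarrow> nat) \<times> (nat \<Rightarrow> nat) \<Rightarrow> nat \<Rightarrow> nat" where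
  "snake_word n m = (\<lambda>(a, w). \<lambda>i\<in>{1..n}. snake m (a i) (w i))"

lemma snake_word_bij:
  "bij_betw (snake_word n m) (words n l \<times> words n m) (words n (l * m))"
proof -
  let ?S = "\<lambda>(x, y). snake m x y" and ?D = "{..<l} \<times> {..<m}"
  define G where "G = inv_into ?D ?S"
  have S: "snake m x y < l * m" if "x < l" "y < m" for x y
    using bij_betw_apply[OF snake_bij[of m l], of "(x, y)"] that by simp
  have GS: "G (snake m x y) = (x, y)" if "x < l" "y < m" for x y
    using bij_betw_inv_into_left[OF snake_bij[of m l], of "(x, y)"] that by (simp add: G_def)
  have G: "fst (G z) < l" "snd (G z) < m" if "z < l * m" for z
    using bij_betw_apply[OF bij_betw_inv_into[OF snake_bij[of m l]], of z] that
    by (auto simp: G_def)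
  have SG: "snake m (fst (G z)) (snd (G z)) = z" if "z < l * m" for z
    using bij_betw_inv_into_right[OF snake_bij[of m l], of z] that
    by (auto simp: G_def case_prod_unfold)
  show ?thesis
    by (rule bij_betwI[where g = "\<lambda>z. (\<lambda>i\<in>{1..n}. fst (G (z i)), \<lambda>i\<in>{1..n}. snd (G (z i)))"])
       (auto simp: snake_word_def words_def S GS G SG PiE_iff extensional_def fun_eq_iff)
qed

text \<open>Only ties \<open>a i = a j\<close> matter. In an even row the snake condition for
  \<open>i < j\<close> reads \<open>std_less w i j\<close>; in an odd row both the direction and the
  parity flip, giving \<open>std_less w j i\<close>. In the class of \<open>p\<close> these say
  \<open>p i < p j\<close> and \<open>p j < p i\<close>.\<close>

lemma snake_word_compat_iff:
  assumes "odd m" "p permutes {1..n}" "a \<in> words n l" "w \<in> std_class n p m"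
  shows "snake_word n m (a, w) \<in> compat_seqs n (\<lambda>_. True) (l * m) \<longleftrightarrow> a \<in> compat_seqs n (asc p) l"
proof -
  have injp: "inj_on p {1..n}" using permutes_inj[OF assms(2)] by (rule inj_on_subset) simp
  have w: "w \<in> words n m" using assms(4) by (simp add: std_class_def)
  have wm: "w i < m" if "i \<in> {1..n}" for i using w that by (auto simp: words_def)
  have z: "snake_word n m (a, w) \<in> words n (l * m)"
    using bij_betw_apply[OF snake_word_bij, of "(a, w)" n l m] assms(3) w by simp
  have zi: "snake_word n m (a, w) i = snake m (a i) (w i)" if "i \<in> {1..n}" for i
    using that by (simp add: snake_word_def)
  have key: "(snake m (a i) (w i) < snake m (a j) (w j) \<or> snake m (a i) (w i) = snake m (a j) (w j) \<and>
              (if even (snake m (a i) (w i)) then i < j else j < i))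
         \<longleftrightarrow> (a i < a j \<or> a i = a j \<and> (if even (a i) then p i < p j else p j < p i))"
    if "i \<in> {1..n}" "j \<in> {1..n}" "i < j" for i j
  proof -
    have p: "p i < p j \<longleftrightarrow> std_less w i j" "p j < p i \<longleftrightarrow> std_less w j i"
      using assms(4) that by (auto simp: std_class_def)
    have eq: "snake m (a i) (w i) = snake m (a j) (w j) \<longleftrightarrow> a i = a j \<and> w i = w j"
      using snake_inj[OF wm[OF that(1)] wm[OF that(2)], of "a i" "a j"] by auto
    show ?thesis
      unfolding p eq snake_less_iff[OF wm[OF that(1)] wm[OF that(2)]]
        even_snake_iff[OF assms(1) wm[OF that(1)]] std_less_def
      using that(3) by auto
  qed
  have "(\<forall>i\<in>{1..n}. \<forall>j\<in>{1..n}. i < j \<longrightarrow> snake_word n m (a, w) i < snake_word n m (a, w) j \<or>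
          snake_word n m (a, w) i = snake_word n m (a, w) j \<and>
          (if even (snake_word n m (a, w) i) then id i < id j else id j < id i))
      \<longleftrightarrow> (\<forall>i\<in>{1..n}. \<forall>j\<in>{1..n}. i < j \<longrightarrow> a i < a j \<or>
          a i = a j \<and> (if even (a i) then p i < p j else p j < p i))"
  proof (intro ball_cong refl)
    fix i j assume ij: "i \<in> {1..n}" "j \<in> {1..n}"
    show "(i < j \<longrightarrow> snake_word n m (a, w) i < snake_word n m (a, w) j \<or>
          snake_word n m (a, w) i = snake_word n m (a, w) j \<and>
          (if even (snake_word n m (a, w) i) then id i < id j else id j < id i))
      \<longleftrightarrow> (i < j \<longrightarrow> a i < a j \<or>
          a i = a j \<and> (if even (a i) then p i < p j else p j < p i))"
      unfolding zi[OF ij(1)] zi[OF ij(2)] id_apply using key[OF ij] by blast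
  qed
  moreover have id: "(\<lambda>_. True) = asc id" by (simp add: asc_def fun_eq_iff)
  ultimately show ?thesis
    unfolding id compat_seqs_iff_pairs[OF injp] compat_seqs_iff_pairs[OF inj_on_id]
    using z assms(3) by blast
qed

text \<open>The sum counts pairs \<open>(a, w)\<close> where \<open>a\<close> is compatible with the
  standardization of \<open>w\<close>; the snake turns them into compatible sequences for the
  identity.\<close>

lemma sum_card_compat_seqs_inv:
  assumes "odd m"
  shows "(\<Sum>p | p permutes {1..n}. card (compat_seqs n (asc p) l) * card (compat_seqs n (asc (inv p)) m))
           = card (compat_seqs n (\<lambda>_. True) (l * m))"
proof -
  let ?Z = "\<Union>p\<in>{p. p permutes {1..n}}. compat_seqs n (asc p) l \<times> std_class n p m"
  have "(\<Sum>p | p permutes {1..n}. card (compat_seqs n (asc p) l) * card (compat_seqs n (asc (inv p)) m))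
      = (\<Sum>p | p permutes {1..n}. card (compat_seqs n (asc p) l \<times> std_class n p m))"
    by (rule sum.cong) (simp_all add: card_cartesian_product card_std_class)
  also have "\<dots> = card ?Z"
    by (rule card_UN_disjoint[symmetric])
       (use std_class_disjoint in \<open>auto simp: finite_permutations\<close>)
  finally have eq: "(\<Sum>p | p permutes {1..n}. card (compat_seqs n (asc p) l) * card (compat_seqs n (asc (inv p)) m))
      = card ?Z" .
  have "bij_betw (snake_word n m) ?Z (compat_seqs n (\<lambda>_. True) (l * m))"
  proof (rule bij_betw_subset[OF snake_word_bij[of n m l]])
    have cw: "compat_seqs n \<delta> k \<subseteq> words n k" for \<delta> k by (auto simp: compat_seqs_def words_def)
    show "?Z \<subseteq> words n l \<times> words n m"
      using cw by (auto simp: std_class_def)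
    show "snake_word n m ` ?Z = compat_seqs n (\<lambda>_. True) (l * m)"
    proof
      show "snake_word n m ` ?Z \<subseteq> compat_seqs n (\<lambda>_. True) (l * m)"
        using snake_word_compat_iff[OF assms] cw by fast
      show "compat_seqs n (\<lambda>_. True) (l * m) \<subseteq> snake_word n m ` ?Z"
      proof
        fix z assume z: "z \<in> compat_seqs n (\<lambda>_. True) (l * m)"
        hence "z \<in> snake_word n m ` (words n l \<times> words n m)"
          using cw bij_betw_imp_surj_on[OF snake_word_bij[of n m l]] by blast
        then obtain a w where aw: "z = snake_word n m (a, w)" "a \<in> words n l" "w \<in> words n m" by blast
        then obtain p where p: "p permutes {1..n}" "w \<in> std_class n p m" using std_class_exists by blast
        hence "a \<in> compat_seqs n (asc p) l"
          using snake_word_compat_iff[OF assms p(1) aw(2) p(2)] z aw(1) by simp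
        thus "z \<in> snake_word n m ` ?Z" using aw p by blast
      qed
    qed
  qed
  from bij_betw_same_card[OF this] eq show ?thesis by simp
qed

section \<open>Passing from counts to peak polynomials\<close>

text \<open>The argument \<open>k\<close> of a sequence stands for the odd alphabet size
  \<open>2 * k + 1\<close>.\<close>

definition lin_func :: "((nat \<Rightarrow> 'a::field) \<Rightarrow> 'a) \<Rightarrow> bool" where
  "lin_func \<Phi> \<longleftrightarrow> (\<forall>f g. \<Phi> (\<lambda>k. f k + g k) = \<Phi> f + \<Phi> g) \<and> (\<forall>c f. \<Phi> (\<lambda>k. c * f k) = c * \<Phi> f)"

lemma lin_func_sum:
  assumes "lin_func \<Phi>"
  shows "\<Phi> (\<lambda>k. \<Sum>i\<in>A. c i * f i k) = (\<Sum>i\<in>A. c i * \<Phi> (f i))"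
proof -
  have add: "\<Phi> (\<lambda>k. f k + g k) = \<Phi> f + \<Phi> g" and scale: "\<Phi> (\<lambda>k. c * f k) = c * \<Phi> f" for f g c
    using assms by (auto simp: lin_func_def)
  have "\<Phi> (\<lambda>k. 0) = 0" using scale[of 0 "\<lambda>_. 0"] by simp
  thus ?thesis by (induction A rule: infinite_finite_induct) (simp_all add: add scale)
qed

text \<open>Iterated forward difference, taken innermost first so that \<open>asc_count_diff\<close>
  rewrites directly.\<close>

primrec fdiff :: "nat \<Rightarrow> (nat \<Rightarrow> 'a::field) \<Rightarrow> nat \<Rightarrow> 'a" where
  "fdiff 0 f = f"
| "fdiff (Suc r) f = fdiff r (\<lambda>k. f (Suc k) - f k)"

lemma fdiff_add: "fdiff r (\<lambda>k. f k + g k) k = fdiff r f k + fdiff r g k"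
proof (induction r arbitrary: f g k)
  case (Suc r)
  show ?case using Suc[of "\<lambda>k. f (Suc k) - f k" "\<lambda>k. g (Suc k) - g k" k] by (simp add: algebra_simps)
qed simp

lemma fdiff_scale: "fdiff r (\<lambda>k. c * f k) k = c * fdiff r f k"
proof (induction r arbitrary: f k)
  case (Suc r)
  show ?case using Suc[of "\<lambda>k. f (Suc k) - f k" k] by (simp add: algebra_simps)
qed simp

lemma fdiff_shift: "fdiff r (\<lambda>k. f (Suc k)) k = fdiff r f (Suc k)"
  by (induction r arbitrary: f) simp_all

text \<open>Each difference lowers the length by one and doubles the number of terms:
  \<open>asc_count i\<close> behaves as a polynomial of degree \<open>i\<close>. This triangularity
  is the linear independence used below.\<close>

lemma fdiff_asc_count:
  "i \<le> r \<Longrightarrow> fdiff r (asc_count i) k = (if i = r then 2 ^ r else 0 :: 'a::field_char_0)"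
proof (induction r arbitrary: i k)
  case 0
  thus ?case by simp
next
  case (Suc r)
  show ?case
  proof (cases i)
    case 0
    have "fdiff r (\<lambda>k. 0) k = (0 :: 'a)" using fdiff_scale[of r 0 "\<lambda>_. 0"] by simp
    thus ?thesis using 0 by simp
  next
    case (Suc j)
    have "fdiff (Suc r) (asc_count i) k = fdiff r (\<lambda>k. asc_count j (Suc k) + asc_count j k :: 'a) k"
      by (simp only: fdiff.simps Suc asc_count_diff)
    also have "\<dots> = fdiff r (asc_count j) (Suc k) + fdiff r (asc_count j) k"
      by (simp add: fdiff_add fdiff_shift)
    finally show ?thesis using Suc.IH[of j] Suc Suc.prems by simp
  qed
qed

text \<open>Triangular interpolation: a multiple of the difference of order \<open>Suc n\<close> at
  0 corrects the newest value and vanishes on the earlier sequences.\<close>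

lemma ex_lin_func_asc_count:
  fixes y :: "nat \<Rightarrow> 'a::field_char_0"
  shows "\<exists>\<Phi>. lin_func \<Phi> \<and> (\<forall>i\<le>n. \<Phi> (asc_count i) = y i)"
proof (induction n)
  case 0
  have "lin_func (\<lambda>f. f 0 * y 0)" by (simp add: lin_func_def algebra_simps)
  thus ?case by (intro exI[of _ "\<lambda>f. f 0 * y 0"]) simp
next
  case (Suc n)
  then obtain \<Phi> where \<Phi>: "lin_func \<Phi>" "\<And>i. i \<le> n \<Longrightarrow> \<Phi> (asc_count i) = y i" by blast
  define c where "c = (y (Suc n) - \<Phi> (asc_count (Suc n))) / 2 ^ Suc n"
  define \<Psi> where "\<Psi> f = \<Phi> f + fdiff (Suc n) f 0 * c" for f
  have "lin_func \<Psi>"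
    using \<Phi>(1) unfolding lin_func_def \<Psi>_def
    by (simp add: fdiff_add fdiff_scale algebra_simps del: fdiff.simps)
  moreover have "\<Psi> (asc_count i) = y i" if "i \<le> Suc n" for i
    using that \<Phi>(2)[of i] fdiff_asc_count[OF that, of 0, where 'a = 'a]
    by (cases "i = Suc n") (auto simp: \<Psi>_def c_def simp del: fdiff.simps)
  ultimately show ?case by blast
qed

definition compat_count :: "nat \<Rightarrow> (nat \<Rightarrow> nat) \<Rightarrow> nat \<Rightarrow> 'a::field_char_0" where
  "compat_count n p k = of_nat (card (compat_seqs n (asc p) (2 * k + 1)))"

text \<open>The values are tuned so that the alternating sum in \<open>card_compat_seqs_odd\<close>
  collapses. The index \<open>n\<close> stays fixed when permutations of a smaller
  \<open>[m]\<close> are evaluated.\<close>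

locale lpk_functional =
  fixes \<Phi> :: "(nat \<Rightarrow> 'a::field_char_0) \<Rightarrow> 'a" and n :: nat and s :: 'a
  assumes lin: "lin_func \<Phi>"
    and asc_count: "i \<le> n \<Longrightarrow> \<Phi> (asc_count i) = (1 - s) ^ ((n - i) div 2)"
begin

text \<open>The binomial sum is \<open>(1 - (1 - s)) ^ L\<close>; the shorter length
  \<open>m\<close> leaves the other factor.\<close>

lemma compat_count:
  assumes "m \<le> n" "even (n - m)" "p permutes {1..m}"
  shows "\<Phi> (compat_count m p) = (1 - s) ^ ((n - m) div 2) * s ^ lpk m p"
proof -
  define L where "L = desc_runs m (asc p)"
  have L: "2 * L \<le> m" unfolding L_def by (rule two_desc_runs_le)
  have "compat_count m p =
      (\<lambda>k. \<Sum>l\<le>L. (-1) ^ l * of_nat (L choose l) * (asc_count (m - 2 * l) k :: 'a))"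
    by (simp only: fun_eq_iff compat_count_def card_compat_seqs_odd L_def) simp
  hence "\<Phi> (compat_count m p) = (\<Sum>l\<le>L. (-1) ^ l * of_nat (L choose l) * \<Phi> (asc_count (m - 2 * l)))"
    by (simp only: lin_func_sum[OF lin])
  also have "\<dots> = (\<Sum>l\<le>L. (1 - s) ^ ((n - m) div 2) * (of_nat (L choose l) * (- (1 - s)) ^ l * 1 ^ (L - l)))"
  proof (rule sum.cong[OF refl])
    fix l assume "l \<in> {..L}"
    hence "(n - (m - 2 * l)) div 2 = (n - m) div 2 + l"
      using L assms(1,2) by (auto elim!: evenE)
    hence "\<Phi> (asc_count (m - 2 * l)) = (1 - s) ^ ((n - m) div 2) * (1 - s) ^ l"
      using assms(1) by (subst asc_count) (auto simp: power_add)
    thus "(-1) ^ l * of_nat (L choose l) * \<Phi> (asc_count (m - 2 * l)) =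
        (1 - s) ^ ((n - m) div 2) * (of_nat (L choose l) * (- (1 - s)) ^ l * 1 ^ (L - l))"
      by (simp only: power_minus[of "1 - s"] power_one mult_1_left mult_1_right mult_ac)
  qed
  also have "\<dots> = (1 - s) ^ ((n - m) div 2) * (- (1 - s) + 1) ^ L"
    by (simp only: binomial_ring sum_distrib_left)
  also have "L = lpk m p"
    unfolding L_def using lpk_eq_desc_runs[OF permutes_inj[OF assms(3)]] by simp
  finally show ?thesis by simp
qed

text \<open>By \<open>sum_card_compat_seqs\<close> the power is the sum of all
  \<open>compat_count m p\<close>.\<close>

lemma power_odd:
  assumes "m \<le> n" "even (n - m)"
  shows "\<Phi> (\<lambda>k. of_nat (2 * k + 1) ^ m) = (1 - s) ^ ((n - m) div 2) * P_lpk m s"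
proof -
  have "(\<lambda>k. of_nat (2 * k + 1) ^ m) = (\<lambda>k. \<Sum>p | p permutes {1..m}. 1 * (compat_count m p k :: 'a))"
    using sum_card_compat_seqs[of m, symmetric]
    by (simp add: fun_eq_iff compat_count_def del: of_nat_Suc flip: of_nat_power of_nat_sum)
  hence "\<Phi> (\<lambda>k. of_nat (2 * k + 1) ^ m) = (\<Sum>p | p permutes {1..m}. 1 * \<Phi> (compat_count m p))"
    by (simp only: lin_func_sum[OF lin])
  also have "\<dots> = (\<Sum>p | p permutes {1..m}. (1 - s) ^ ((n - m) div 2) * s ^ lpk m p)"
    by (rule sum.cong) (use assms compat_count in auto)
  finally show ?thesis by (simp add: P_lpk_def sum_distrib_left)
qed

end

section \<open>Separation of variables and the final series\<close>

lemma sum_compat_count: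
  "(\<Sum>p | p permutes {1..n}. compat_count n p k * compat_count n (inv p) l) =
     (\<Sum>m\<le>n. gf_coeff 1 n m * (of_nat (2 * k + 1) ^ m * of_nat (2 * l + 1) ^ m :: 'a::field_char_0))"
proof -
  \<comment> \<open>A product of odd sizes is odd, so \<open>asc_count\<close> covers the product
    alphabet.\<close>
  have N: "(2 * k + 1) * (2 * l + 1) = 2 * (2 * k * l + k + l) + 1" by (simp add: algebra_simps)
  have "(\<Sum>p | p permutes {1..n}. compat_count n p k * compat_count n (inv p) l) =
      (of_nat (card (compat_seqs n (\<lambda>_. True) ((2 * k + 1) * (2 * l + 1)))) :: 'a)"
    unfolding compat_count_def
    by (subst sum_card_compat_seqs_inv[symmetric]) (simp_all only: of_nat_sum of_nat_mult, simp)
  also have "\<dots> = asc_count n (2 * k * l + k + l)" by (simp only: N asc_count_def)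
  also have "\<dots> = (\<Sum>m\<le>n. gf_coeff 1 n m * of_nat (2 * (2 * k * l + k + l) + 1) ^ m)"
    by (rule asc_count_expand)
  finally show ?thesis by (simp only: N[symmetric] of_nat_mult power_mult_distrib)
qed

lemma P_lpk_ilpk_expand:
  fixes s t r :: "'a::field_char_0"
  assumes "r ^ 2 = (1 - s) * (1 - t)"
  shows "P_lpk_ilpk n s t = (\<Sum>m\<le>n. gf_coeff r n m * (P_lpk m s * P_lpk m t))"
proof -
  obtain \<Phi> where \<Phi>: "lin_func \<Phi>" "\<And>i. i \<le> n \<Longrightarrow> \<Phi> (asc_count i) = (1 - s) ^ ((n - i) div 2)"
    using ex_lin_func_asc_count[of n "\<lambda>i. (1 - s) ^ ((n - i) div 2)"] by blast
  obtain \<Psi> where \<Psi>: "lin_func \<Psi>" "\<And>i. i \<le> n \<Longrightarrow> \<Psi> (asc_count i) = (1 - t) ^ ((n - i) div 2)"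
    using ex_lin_func_asc_count[of n "\<lambda>i. (1 - t) ^ ((n - i) div 2)"] by blast
  interpret S: lpk_functional \<Phi> n s by unfold_locales (use \<Phi> in auto)
  interpret T: lpk_functional \<Psi> n t by unfold_locales (use \<Psi> in auto)
  have "P_lpk_ilpk n s t =
      (\<Sum>p | p permutes {1..n}. \<Psi> (compat_count n (inv p)) * \<Phi> (compat_count n p))"
    unfolding P_lpk_ilpk_def ilpk_def
    by (rule sum.cong) (simp_all add: S.compat_count T.compat_count permutes_inv)
  also have "\<dots> = \<Phi> (\<lambda>k. \<Sum>p | p permutes {1..n}. \<Psi> (compat_count n (inv p)) * compat_count n p k)"
    by (simp only: lin_func_sum[OF \<Phi>(1)])
  \<comment> \<open>\<open>\<Psi>\<close> acts in \<open>l\<close> with \<open>k\<close> frozen, so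
    \<open>compat_count n p k\<close> is a scalar for it.\<close>
  also have "(\<lambda>k. \<Sum>p | p permutes {1..n}. \<Psi> (compat_count n (inv p)) * compat_count n p k) =
      (\<lambda>k. \<Psi> (\<lambda>l. \<Sum>p | p permutes {1..n}. compat_count n p k * compat_count n (inv p) l))"
    by (simp only: lin_func_sum[OF \<Psi>(1)] mult.commute)
  also have "\<dots> = (\<lambda>k. \<Psi> (\<lambda>l. \<Sum>m\<le>n. (gf_coeff 1 n m * of_nat (2 * k + 1) ^ m) * of_nat (2 * l + 1) ^ m))"
    by (simp only: sum_compat_count mult.assoc)
  also have "\<dots> = (\<lambda>k. \<Sum>m\<le>n. (gf_coeff 1 n m * \<Psi> (\<lambda>l. of_nat (2 * l + 1) ^ m)) * of_nat (2 * k + 1) ^ m)"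
    by (simp only: lin_func_sum[OF \<Psi>(1)]) (simp only: mult_ac)
  also have "\<Phi> \<dots> = (\<Sum>m\<le>n. (gf_coeff 1 n m * \<Psi> (\<lambda>l. of_nat (2 * l + 1) ^ m)) * \<Phi> (\<lambda>k. of_nat (2 * k + 1) ^ m))"
    by (simp only: lin_func_sum[OF \<Phi>(1)])
  also have "\<dots> = (\<Sum>m\<le>n. gf_coeff r n m * (P_lpk m s * P_lpk m t))"
  proof (rule sum.cong[OF refl])
    fix m assume "m \<in> {..n}"
    hence m: "m \<le> n" by simp
    show "gf_coeff 1 n m * \<Psi> (\<lambda>l. of_nat (2 * l + 1) ^ m) * \<Phi> (\<lambda>k. of_nat (2 * k + 1) ^ m)
        = gf_coeff r n m * (P_lpk m s * P_lpk m t)"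
    \<comment> \<open>For even \<open>n - m\<close> the power of \<open>r\<close> splits into the
      factors produced by the two functionals; for odd \<open>n - m\<close> both sides
      vanish.\<close>
    proof (cases "even (n - m)")
      case True
      hence "r ^ (n - m) = (r ^ 2) ^ ((n - m) div 2)"
        by (simp flip: power_mult)
      hence "gf_coeff r n m = gf_coeff 1 n m * ((1 - s) ^ ((n - m) div 2) * (1 - t) ^ ((n - m) div 2))"
        by (subst gf_coeff_scaling) (simp add: assms power_mult_distrib)
      thus ?thesis
        unfolding S.power_odd[OF m True] T.power_odd[OF m True] by (simp add: mult_ac)
    qed (simp add: gf_coeff_odd)
  qed
  finally show ?thesis .
qed

text \<open>Each coefficient of the partial sums is eventually constant, which is convergence of
  formal power series.\<close>

lemma fps_sums_by_order:
  fixes f :: "nat \<Rightarrow> 'a::comm_ring_1 fps"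
  assumes "\<And>k n. n < k \<Longrightarrow> fps_nth (f k) n = 0"
  shows "f sums Abs_fps (\<lambda>n. \<Sum>k\<le>n. fps_nth (f k) n)"
  unfolding sums_def
proof (rule tendsto_fpsI)
  fix n
  have "fps_nth (\<Sum>k<N. f k) n = (\<Sum>k\<le>n. fps_nth (f k) n)" if "N > n" for N
    unfolding fps_sum_nth by (rule sum.mono_neutral_right) (use that assms in auto)
  thus "eventually (\<lambda>N. fps_nth (\<Sum>k<N. f k) n = fps_nth (Abs_fps (\<lambda>n. \<Sum>k\<le>n. fps_nth (f k) n)) n) sequentially"
    by (intro eventually_mono[OF eventually_gt_at_top[of n]]) simp
qed

text \<open>The root \<open>r\<close> is a parameter because the field may lack one; by
  \<open>gf_coeff_scaling\<close> and \<open>gf_coeff_odd\<close> its sign does not matter.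
  Summability is asserted because \<open>suminf\<close> alone does not imply convergence.\<close>

theorem theorem4p5:
  fixes s t r :: "'a::field_char_0"
  assumes "r ^ 2 = (1 - s) * (1 - t)"
  shows "summable (\<lambda>k. fps_const (1 / fact k) * L_quot r ^ k
                        * fps_const (P_lpk k s * P_lpk k t)) \<and>
         Abs_fps (\<lambda>n. P_lpk_ilpk n s t) =
           1 / fps_sqrt1 (1 - fps_const ((1 - s) * (1 - t)) * fps_X ^ 2)
           * (\<Sum>k. fps_const (1 / fact k) * L_quot r ^ k
                    * fps_const (P_lpk k s * P_lpk k t))"
proof -
  define f where "f k = fps_const (1 / fact k) * L_quot r ^ k * fps_const (P_lpk k s * P_lpk k t)" for k
  define Q where "Q = fps_sqrt1 (1 - fps_const ((1 - s) * (1 - t)) * fps_X ^ 2)"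
  have f0: "fps_nth (f k) n = 0" if "n < k" for n k
    using that startsby_zero_power_prefix[of "L_quot r" k] by (simp add: f_def L_quot_nth)
  note sums = fps_sums_by_order[of f, OF f0]
  have "Abs_fps (\<lambda>n. P_lpk_ilpk n s t) = inverse Q * suminf f"
  proof (rule fps_ext)
    fix n
    have "fps_nth (inverse Q * suminf f) n = (\<Sum>i=0..n. fps_nth (inverse Q) i * (\<Sum>k\<le>n - i. fps_nth (f k) (n - i)))"
      by (simp add: sums_unique[OF sums, symmetric] fps_mult_nth)
    also have "\<dots> = (\<Sum>i=0..n. fps_nth (inverse Q) i * (\<Sum>k\<le>n. fps_nth (f k) (n - i)))"
      by (intro sum.cong arg_cong2[where f = "(*)"] sum.mono_neutral_left refl) (auto simp: f0)
    also have "\<dots> = (\<Sum>k\<le>n. fps_nth (inverse Q * f k) n)"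
      unfolding fps_mult_nth by (subst sum.swap) (simp only: sum_distrib_left)
    also have "\<dots> = (\<Sum>k\<le>n. gf_coeff r n k * (P_lpk k s * P_lpk k t))"
    proof (rule sum.cong[OF refl])
      fix k
      have "inverse Q * f k = fps_const (1 / fact k * (P_lpk k s * P_lpk k t)) * (inverse Q * L_quot r ^ k)"
        by (subst fps_const_mult[symmetric]) (simp only: f_def mult_ac)
      thus "fps_nth (inverse Q * f k) n = gf_coeff r n k * (P_lpk k s * P_lpk k t)"
        by (simp only: fps_mult_left_const_nth gf_coeff_def Q_def assms) simp
    qed
    also have "\<dots> = P_lpk_ilpk n s t" by (rule P_lpk_ilpk_expand[OF assms, symmetric])
    finally show "fps_nth (Abs_fps (\<lambda>n. P_lpk_ilpk n s t)) n = fps_nth (inverse Q * suminf f) n" by simp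
  qed
  moreover have "1 / Q = inverse Q" by (simp add: Q_def fps_divide_unit)
  ultimately have "summable f \<and> Abs_fps (\<lambda>n. P_lpk_ilpk n s t) = 1 / Q * suminf f"
    using sums_summable[OF sums] by (simp only:)
  thus ?thesis unfolding Q_def f_def .
qed

end
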